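(* Let $D$ and $b$ be positive integers. If $\Gamma$ is a distance-regular graph with classical parameters $(D,b,\alpha,\beta)$ such that $D\geq 9$ and $b\geq 2$, then $(b+1)\alpha$ is a non-negative integer and one of the following holds: (i) $\alpha\leq b(b+1)$; (ii) $b(b+1)<\alpha<b^2(b+1)+1$ and $\beta<\bigl(b(b+1)^2-\alpha\bigr)\left[\begin{smallmatrix} D\\ 1\end{smallmatrix}\right]_b+(b+1)^6b+\Bigl(\frac{(b+1)^3((b+1)^2+1)}{2}+1\Bigr)\alpha-b$. Moreover, if $D\geq 10$ then $\alpha\leq b^2(b+1)$.
   Context: A connected graph $\Gamma$ of diameter $D$ is distance-regular if for each $0\le i\le D$ there are integers $b_i,c_i$ such that for any two vertices $x,y$ at distance $i$, exactly $c_i$ neighbours of $y$ are at distance $i-1$ from $x$ and exactly $b_i$ at distance $i+1$. Write $\left[\begin{smallmatrix} i\\ 1\end{smallmatrix}\right]_b=1+b+\dots+b^{i-1}$. $\Gamma$ has classical parameters $(D,b,\alpha,\beta)$ if $c_i=\left[\begin{smallmatrix} i\\ 1\end{smallmatrix}\right]_b(1+\alpha\left[\begin{smallmatrix} i-1\\ 1\end{smallmatrix}\right]_b)$ and $b_i=(\left[\begin{smallmatrix} D\\ 1\end{smallmatrix}\right]_b-\left[\begin{smallmatrix} i\\ 1\end{smallmatrix}\right]_b)(\beta-\alpha\left[\begin{smallmatrix} i\\ 1\end{smallmatrix}\right]_b)$ for all $0\le i\le D$. *)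

theory Defs
  imports "Graph_Theory.Graph_Theory"
begin

text \<open>
  Finite simple undirected graphs are the symmetric digraphs of \<^locale>\<open>graph\<close>: no loops, no
  multiple arcs, finite vertex set, and every edge is represented by its two opposite arcs.
  The distance is the cost of a shortest walk, every arc having cost one; it is infinite between
  vertices that are not joined by a walk.
\<close>

definition graph_dist :: "('a, 'e) pre_digraph \<Rightarrow> 'a \<Rightarrow> 'a \<Rightarrow> ereal" where
  "graph_dist G x y = wf_digraph.\<mu> G (\<lambda>_. 1) x y"

definition graph_diameter :: "('a, 'e) pre_digraph \<Rightarrow> ereal" where
  "graph_diameter G = (SUP x\<in>verts G. SUP y\<in>verts G. graph_dist G x y)"

text \<open>
  The subtraction in the first set below is on the reals, so that for \<open>i = 0\<close> the set is empty and
  \<open>c 0 = 0\<close>; likewise \<open>b i = 0\<close> if \<open>i\<close> is the diameter.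
\<close>

definition intersection_numbers ::
  "('a, 'e) pre_digraph \<Rightarrow> nat \<Rightarrow> (nat \<Rightarrow> int) \<Rightarrow> (nat \<Rightarrow> int) \<Rightarrow> bool" where
  "intersection_numbers G D b c \<longleftrightarrow>
     (\<forall>i\<le>D. \<forall>x\<in>verts G. \<forall>y\<in>verts G. graph_dist G x y = ereal (real i) \<longrightarrow>
        int (card {z. y \<rightarrow>\<^bsub>G\<^esub> z \<and> graph_dist G x z = ereal (real i - 1)}) = c i \<and>
        int (card {z. y \<rightarrow>\<^bsub>G\<^esub> z \<and> graph_dist G x z = ereal (real i + 1)}) = b i)"

definition distance_regular :: "('a, 'e) pre_digraph \<Rightarrow> bool" where
  "distance_regular G \<longleftrightarrow> Digraph.graph G \<and> Digraph_Component.connected G \<and>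
     (\<exists>D b c. graph_diameter G = ereal (real D) \<and> intersection_numbers G D b c)"

definition qnum :: "int \<Rightarrow> nat \<Rightarrow> real" where
  "qnum b i = (\<Sum>j<i. real_of_int b ^ j)"

text \<open>
  For \<open>i = 0\<close> the natural number \<open>i - 1\<close> is \<open>0\<close>, but this value is irrelevant because the factor
  \<open>qnum b i\<close> vanishes.
\<close>

definition has_classical_parameters ::
  "('a, 'e) pre_digraph \<Rightarrow> nat \<Rightarrow> int \<Rightarrow> real \<Rightarrow> real \<Rightarrow> bool" where
  "has_classical_parameters G D b \<alpha> \<beta> \<longleftrightarrow>
     graph_diameter G = ereal (real D) \<and>
     (\<exists>bs cs. intersection_numbers G D bs cs \<and>
        (\<forall>i\<le>D. real_of_int (cs i) = qnum b i * (1 + \<alpha> * qnum b (i - 1)) \<and>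
               real_of_int (bs i) = (qnum b D - qnum b i) * (\<beta> - \<alpha> * qnum b i)))"

end

(*
  For b >= 2 the cosine matrix of the second largest eigenvalue forces every eigenvalue of a local
  graph to be at least -(b + 1), and that of the smallest eigenvalue bounds the cliques of a local
  graph by beta. Write m = b + 1 and p = b m. Testing the least eigenvalue of a local graph on a
  vertex together with a large clique shows that a vertex outside the clique has at most p
  neighbours in it; testing it on a star shows that the neighbourhood of a vertex contains no
  coclique of size m^2 + 1 and at most m large, mutually separated cliques. A maximum coclique of the
  neighbourhood of a vertex splits this neighbourhood into cliques, up to the vertices adjacent to
  two elements of the coclique, and each such pair has fewer than c_2 common neighbours. Thus the
  valency a_1 of the local graph is essentially at most m times the size of a largest clique.

  Counting the edges that leave a large maximal clique of size n gives
  n (a_1 + 1 - n) <= p (k - n). For alpha > p this yields n <= p [D], whence the bound on beta. For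
  alpha > b p it even yields n <= (a_1 + 1) / (2 m), so that a_1 is bounded, contradicting
  beta >= 1 + alpha [D - 1] when D >= 9.
*)
theory Submission
  imports Defs
begin

section \<open>Graphs with bounded least eigenvalue\<close>

text \<open>The intended instance is the local graph of a vertex, with \<open>m\<close> = q + 1 and
  \<open>M\<close> = \<open>c 2\<close> - 1. That no eigenvalue lies below -m is expressed as
  positive semidefiniteness of A + m I, so that test vectors can be inserted directly.\<close>

locale graph_least_eigenvalue =
  fixes X :: "'a set" and adj :: "'a \<Rightarrow> 'a \<Rightarrow> bool" and m M :: nat
  assumes finite_X: "finite X"
    and adj_sym: "adj u v \<Longrightarrow> adj v u"
    and adj_irrefl: "\<not> adj v v"
    and m_pos: "m > 0"
    and least_eigenvalue:
      "0 \<le> (\<Sum>u\<in>X. \<Sum>v\<in>X. if adj u v then w u * w v else 0) + real m * (\<Sum>u\<in>X. (w u)\<^sup>2)"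
    and common_nbrs:
      "\<lbrakk>u \<in> X; v \<in> X; u \<noteq> v; \<not> adj u v\<rbrakk> \<Longrightarrow> card {z \<in> X. adj u z \<and> adj v z} \<le> M"
begin

lemma adj_commute: "adj u v \<longleftrightarrow> adj v u"
  using adj_sym by blast

definition p :: nat where "p = m * (m - 1)"

definition clique :: "'a set \<Rightarrow> bool" where
  "clique C \<longleftrightarrow> C \<subseteq> X \<and> (\<forall>u\<in>C. \<forall>v\<in>C. u \<noteq> v \<longrightarrow> adj u v)"

definition maximal_clique :: "'a set \<Rightarrow> bool" where
  "maximal_clique C \<longleftrightarrow> clique C \<and> (\<forall>v\<in>X - C. \<exists>u\<in>C. \<not> adj v u)"

section \<open>Test vectors on stars\<close>

text \<open>The test vector is \<open>-f\<close> on \<open>P\<close> with the optimal weight at \<open>y\<close>.\<close>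

lemma weighted_degree_square_le:
  fixes f :: "'a \<Rightarrow> real"
  assumes y: "y \<in> X" and P: "P \<subseteq> X" "y \<notin> P"
  shows "(\<Sum>v\<in>P. if adj y v then f v else 0)\<^sup>2
    \<le> m * ((\<Sum>u\<in>P. \<Sum>v\<in>P. if adj u v then f u * f v else 0) + m * (\<Sum>v\<in>P. (f v)\<^sup>2))"
proof -
  have fP: "finite P" using P finite_X finite_subset by blast
  define A where "A = (\<Sum>v\<in>P. if adj y v then f v else 0)"
  define B where "B = (\<Sum>u\<in>P. \<Sum>v\<in>P. if adj u v then f u * f v else 0)"
  define S where "S = (\<Sum>v\<in>P. (f v)\<^sup>2)"
  define s where "s = A / m"
  define w where "w u = (if u = y then s else if u \<in> P then - f u else 0)" for u
  have sub: "insert y P \<subseteq> X" using y P by auto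
  have w0: "w u = 0" if "u \<notin> insert y P" for u using that by (auto simp: w_def)
  have wP: "w u = - f u" if "u \<in> P" for u using that P by (auto simp: w_def)
  have wy: "w y = s" by (simp add: w_def)
  have inner: "(\<Sum>v\<in>X. if adj u v then w u * w v else 0)
      = (\<Sum>v\<in>insert y P. if adj u v then w u * w v else 0)" for u
    by (rule sum.mono_neutral_right[OF finite_X sub]) (use w0 in auto)
  have "(\<Sum>u\<in>X. \<Sum>v\<in>X. if adj u v then w u * w v else 0)
      = (\<Sum>u\<in>insert y P. \<Sum>v\<in>insert y P. if adj u v then w u * w v else 0)"
    unfolding inner
    by (rule sum.mono_neutral_right[OF finite_X sub]) (use w0 in \<open>auto intro!: sum.neutral\<close>)
  also have "\<dots> = (\<Sum>v\<in>P. if adj y v then w y * w v else 0)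
      + (\<Sum>u\<in>P. (if adj u y then w u * w y else 0) + (\<Sum>v\<in>P. if adj u v then w u * w v else 0))"
    using fP P by (simp add: adj_irrefl)
  also have "(\<Sum>v\<in>P. if adj y v then w y * w v else 0) = - s * A"
    unfolding A_def sum_distrib_left by (rule sum.cong) (auto simp: wP wy)
  also have "(\<Sum>u\<in>P. (if adj u y then w u * w y else 0) + (\<Sum>v\<in>P. if adj u v then w u * w v else 0))
      = (\<Sum>u\<in>P. if adj u y then w u * w y else 0) + B"
    unfolding B_def sum.distrib[symmetric] by (intro sum.cong refl arg_cong2[where f="(+)"]) (auto simp: wP)
  also have "(\<Sum>u\<in>P. if adj u y then w u * w y else 0) = - s * A"
    unfolding A_def sum_distrib_left by (rule sum.cong) (auto simp: wP wy adj_commute)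
  finally have 1: "(\<Sum>u\<in>X. \<Sum>v\<in>X. if adj u v then w u * w v else 0) = B - 2 * s * A" by simp
  have "(\<Sum>u\<in>X. (w u)\<^sup>2) = (\<Sum>u\<in>insert y P. (w u)\<^sup>2)"
    by (rule sum.mono_neutral_right[OF finite_X sub]) (use w0 in auto)
  also have "\<dots> = s\<^sup>2 + S" using fP P by (simp add: wy S_def wP)
  finally have 2: "(\<Sum>u\<in>X. (w u)\<^sup>2) = s\<^sup>2 + S" .
  have "0 \<le> B - 2 * s * A + m * (s\<^sup>2 + S)"
    using least_eigenvalue[of w] unfolding 1 2 .
  also have "\<dots> = B + m * S - A\<^sup>2 / m"
    using m_pos by (simp add: s_def field_simps power2_eq_square)
  finally have "A\<^sup>2 / m \<le> B + m * S" by simp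
  then show ?thesis using m_pos unfolding A_def[symmetric] B_def[symmetric] S_def[symmetric]
    by (simp add: field_simps)
qed

text \<open>Weight 1 on an edgeless set of leaves has vanishing quadratic form, so the star estimate
  reads |S|^2 \<le> m^2 |S|.\<close>

lemma coclique_card_le:
  assumes y: "y \<in> X" and S: "S \<subseteq> {v \<in> X. adj y v}" "\<And>u v. u \<in> S \<Longrightarrow> v \<in> S \<Longrightarrow> \<not> adj u v"
  shows "card S \<le> m\<^sup>2"
proof -
  have "y \<notin> S" using S adj_irrefl by auto
  moreover have "(\<Sum>v\<in>S. if adj y v then 1 else 0 :: real) = card S"
    using S by (subst sum.cong[where h="\<lambda>_. 1", OF refl]) auto
  moreover have "(\<Sum>u\<in>S. \<Sum>v\<in>S. if adj u v then 1 * 1 else 0 :: real) = 0"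
    using S by (intro sum.neutral ballI) auto
  ultimately have "(real (card S))\<^sup>2 \<le> real m * (real m * real (card S))"
    using weighted_degree_square_le[of y S "\<lambda>_. 1"] y S(1) by auto
  then have "real (card S) * real (card S) \<le> real (m\<^sup>2) * real (card S)"
    by (simp add: power2_eq_square)
  then have "card S * card S \<le> m\<^sup>2 * card S"
    by (simp only: of_nat_mult[symmetric] of_nat_le_iff)
  then show ?thesis by (cases "card S = 0") auto
qed

text \<open>Given \<open>p + 1\<close> neighbours of \<open>v\<close> in \<open>C\<close>, put a
  weight of total zero on them and on the non-neighbours of \<open>v\<close> in \<open>C\<close>. On
  a clique the form of such a weight is minus its square norm, and the star estimate then bounds the
  number of non-neighbours by \<open>p * (p + 1)\<close>. But there are more: because of
  \<open>w\<close>, at most \<open>M\<close> elements of \<open>C\<close> are adjacent to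
  \<open>v\<close>.\<close>

lemma clique_nbrs_card_le:
  assumes C: "clique C" "M + p * (p + 1) < card C"
    and v: "v \<in> X - C" and w: "w \<in> C" "\<not> adj v w"
  shows "card {c \<in> C. adj v c} \<le> p"
proof (rule ccontr)
  assume "\<not> ?thesis"
  then obtain T where T: "T \<subseteq> {c \<in> C. adj v c}" "card T = p + 1"
    by (metis Suc_eq_plus1 not_less_eq_eq obtain_subset_with_card_n)
  define U where "U = {c \<in> C. \<not> adj v c}"
  have CX: "C \<subseteq> X" and cl: "\<And>a b. a \<in> C \<Longrightarrow> b \<in> C \<Longrightarrow> a \<noteq> b \<Longrightarrow> adj a b"
    using C by (auto simp: clique_def)
  have fC: "finite C" using CX finite_X finite_subset by blast
  \<comment> \<open>Every neighbour of \<open>v\<close> in \<open>C\<close> differs from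
    \<open>w\<close>, hence is a common neighbour of \<open>v\<close> and \<open>w\<close>.\<close>
  have "card {c \<in> C. adj v c} \<le> card {z \<in> X. adj v z \<and> adj w z}"
    by (rule card_mono) (use finite_X CX cl w in auto)
  also have "\<dots> \<le> M" using common_nbrs[of v w] v w CX by blast
  finally have "card {c \<in> C. adj v c} \<le> M" .
  moreover have "card C = card {c \<in> C. adj v c} + card U"
    unfolding U_def by (subst card_Un_disjoint[symmetric]) (use fC in \<open>auto intro: arg_cong[where f=card]\<close>)
  ultimately have U: "p * (p + 1) < card U" using C by linarith
  \<comment> \<open>\<open>q\<close> is the size of \<open>T\<close>; the weight on \<open>U\<close>
    is chosen to make the total zero.\<close>
  define q where "q = real p + 1"
  define f where "f c = (if c \<in> T then 1 else - q / card U)" for c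
  have fT: "finite T" "T \<subseteq> C" using T fC by (auto intro: finite_subset[of T C])
  have fU: "finite U" "U \<subseteq> C" "T \<inter> U = {}" using fC T by (auto simp: U_def)
  have Un: "\<And>g :: 'a \<Rightarrow> real. sum g (T \<union> U) = sum g T + sum g U"
    using fT fU by (simp add: sum.union_disjoint)
  have fTv: "\<And>c. c \<in> T \<Longrightarrow> f c = 1" and fUv: "\<And>c. c \<in> U \<Longrightarrow> f c = - q / card U"
    using fU by (auto simp: f_def)
  have cU: "card U > 0" using U by linarith
  have "(\<Sum>c\<in>T\<union>U. if adj v c then f c else 0) = (\<Sum>c\<in>T. 1) + (\<Sum>c\<in>U. 0)"
    unfolding Un by (intro arg_cong2[where f="(+)"] sum.cong refl) (use T fTv in \<open>auto simp: U_def\<close>)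
  then have A: "(\<Sum>c\<in>T\<union>U. if adj v c then f c else 0) = q" using T by (simp add: q_def)
  have s0: "(\<Sum>c\<in>T\<union>U. f c) = 0" unfolding Un using T cU by (simp add: fTv fUv q_def)
  have s2: "(\<Sum>c\<in>T\<union>U. (f c)\<^sup>2) = q + q\<^sup>2 / card U" (is "?S = _")
    unfolding Un using T cU by (simp add: fTv fUv q_def power2_eq_square) (simp add: algebra_simps)
  have row: "(\<Sum>d\<in>T\<union>U. if adj c d then f c * f d else 0) = - (f c)\<^sup>2" if c: "c \<in> T \<union> U" for c
  proof -
    have "(\<Sum>d\<in>T\<union>U. if adj c d then f c * f d else 0)
        = (\<Sum>d\<in>T\<union>U. f c * f d - (if d = c then (f c)\<^sup>2 else 0))"
    proof (rule sum.cong[OF refl])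
      fix d assume "d \<in> T \<union> U"
      then have "adj c d \<longleftrightarrow> d \<noteq> c" using c cl fT(2) fU(2) adj_irrefl by blast
      then show "(if adj c d then f c * f d else 0) = f c * f d - (if d = c then (f c)\<^sup>2 else 0)"
        by (simp add: power2_eq_square)
    qed
    also have "\<dots> = f c * (\<Sum>d\<in>T\<union>U. f d) - (f c)\<^sup>2"
      using c fT fU by (simp add: sum_subtractf sum_distrib_left)
    finally show ?thesis using s0 by simp
  qed
  have "(\<Sum>c\<in>T\<union>U. \<Sum>d\<in>T\<union>U. if adj c d then f c * f d else 0) = - ?S"
    by (simp add: row sum_negf del: Un_iff)
  moreover have "T \<union> U \<subseteq> X" "v \<notin> T \<union> U" using fT fU v CX by auto
  ultimately have "q\<^sup>2 \<le> m * (- ?S + m * ?S)"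
    using weighted_degree_square_le[of v "T \<union> U" f] v A by auto
  \<comment> \<open>The form contributes -1 and the norm contributes m, which is the origin of
    \<open>p\<close> = m (m - 1).\<close>
  also have "\<dots> = real p * (q + q\<^sup>2 / card U)"
  proof -
    have "real p = m * (real m - 1)" using m_pos by (simp add: p_def of_nat_diff)
    have id: "m * (- t + m * t) = m * (real m - 1) * t" for t :: real
      by (simp add: algebra_simps)
    show ?thesis unfolding s2 \<open>real p = _\<close> by (rule id)
  qed
  finally have "q\<^sup>2 \<le> real p * (q + q\<^sup>2 / card U)" .
  then have "q * (q * card U) \<le> q * (p * (card U + q))"
    using cU by (simp add: field_simps power2_eq_square)
  then have "q * card U \<le> p * (card U + q)"
    by (rule mult_left_le_imp_le) (simp add: q_def add_nonneg_pos)
  then have "real (card U) \<le> real (p * (p + 1))" by (simp add: q_def algebra_simps)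
  then show False using U by linarith
qed

text \<open>A vertex of the union has at most \<open>L\<close> neighbours in its own part and
  \<open>p\<close> in each of the \<open>m\<close> others. Constant weight on the union turns the
  star estimate into (m + 1) L \<le> m (L + m p + m).\<close>

lemma separated_nbrs_card_le:
  assumes y: "y \<in> X" and I: "card I = m + 1"
    and P: "\<And>i. i \<in> I \<Longrightarrow> P i \<subseteq> {v \<in> X. adj y v}" "\<And>i. i \<in> I \<Longrightarrow> card (P i) = L"
    and disj: "\<And>i j. i \<in> I \<Longrightarrow> j \<in> I \<Longrightarrow> i \<noteq> j \<Longrightarrow> P i \<inter> P j = {}"
    and few: "\<And>i j v. i \<in> I \<Longrightarrow> j \<in> I \<Longrightarrow> i \<noteq> j \<Longrightarrow> v \<in> P i \<Longrightarrow> card {u \<in> P j. adj v u} \<le> p"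
  shows "L \<le> m\<^sup>2 * (p + 1)"
proof (cases "L = 0")
  case False
  have fI: "finite I" using I by (intro card_ge_0_finite) simp
  define Q where "Q = (\<Union>i\<in>I. P i)"
  have fP: "finite (P i)" if "i \<in> I" for i using P(1)[OF that] finite_X by (auto intro: finite_subset)
  have fQ: "finite Q" using fI fP by (auto simp: Q_def)
  have cQ: "card Q = (m + 1) * L"
    unfolding Q_def using fI fP disj P I by (subst card_UN_disjoint) auto
  have Qsub: "Q \<subseteq> X" "y \<notin> Q" using P adj_irrefl by (auto simp: Q_def)
  have "(\<Sum>v\<in>Q. if adj y v then 1 else 0 :: real) = card Q"
    using P by (subst sum.cong[where h="\<lambda>_. 1", OF refl]) (auto simp: Q_def)
  moreover have "(\<Sum>v\<in>Q. if adj u v then 1 * 1 else 0 :: real) \<le> real (L + m * p)" if u: "u \<in> Q" for u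
  proof -
    obtain i where i: "i \<in> I" "u \<in> P i" using u by (auto simp: Q_def)
    have "(\<Sum>v\<in>Q. if adj u v then 1 * 1 else 0 :: real) = card {v \<in> Q. adj u v}"
      using fQ by (simp add: sum.If_cases Int_def)
    also have "{v \<in> Q. adj u v} = (\<Union>j\<in>I. {v \<in> P j. adj u v})" by (auto simp: Q_def)
    also have "card \<dots> \<le> (\<Sum>j\<in>I. card {v \<in> P j. adj u v})" by (rule card_UN_le[OF fI])
    also have "\<dots> = card {v \<in> P i. adj u v} + (\<Sum>j\<in>I - {i}. card {v \<in> P j. adj u v})"
      using fI i by (simp add: sum.remove)
    also have "\<dots> \<le> L + (\<Sum>j\<in>I - {i}. p)"
      using P(2)[OF i(1)] fP[OF i(1)] few i
      by (intro add_mono sum_mono) (auto intro!: card_mono simp flip: P(2)[OF i(1)])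
    also have "\<dots> = L + m * p" using fI I i by simp
    finally show ?thesis by simp
  qed
  then have "(\<Sum>u\<in>Q. \<Sum>v\<in>Q. if adj u v then 1 * 1 else 0 :: real) \<le> (\<Sum>u\<in>Q. real (L + m * p))"
    by (rule sum_mono)
  ultimately have "(real (card Q))\<^sup>2 \<le> m * (card Q * real (L + m * p) + m * card Q)"
  proof -
    assume A: "(\<Sum>v\<in>Q. if adj y v then 1 else 0 :: real) = card Q"
      and B: "(\<Sum>u\<in>Q. \<Sum>v\<in>Q. if adj u v then 1 * 1 else 0 :: real) \<le> (\<Sum>u\<in>Q. real (L + m * p))"
    have "(real (card Q))\<^sup>2
        \<le> m * ((\<Sum>u\<in>Q. \<Sum>v\<in>Q. if adj u v then 1 * 1 else 0 :: real) + real m * (\<Sum>v\<in>Q. 1\<^sup>2))"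
      using weighted_degree_square_le[OF y Qsub, of "\<lambda>_. 1"] unfolding A .
    also have "\<dots> \<le> m * ((\<Sum>u\<in>Q. real (L + m * p)) + real m * (\<Sum>v\<in>Q. 1\<^sup>2))"
      by (intro mult_left_mono add_right_mono B) simp
    finally show ?thesis by simp
  qed
  then have "real (card Q) * card Q \<le> card Q * (m * (real (L + m * p) + m))"
    by (simp add: power2_eq_square algebra_simps)
  moreover have "card Q > 0" using cQ False by simp
  ultimately have "real (card Q) \<le> m * (real (L + m * p) + m)" by (simp only: mult_le_cancel_left_pos of_nat_0_less_iff)
  then have "real ((m + 1) * L) \<le> real (m * (L + m * p + m))" unfolding cQ by simp
  then have "(m + 1) * L \<le> m * (L + m * p + m)" by (simp only: of_nat_le_iff)
  then show ?thesis by (simp add: algebra_simps power2_eq_square)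
qed simp

section \<open>Maximal cliques and the valency\<close>

lemma clique_extend_maximal:
  assumes "clique C"
  obtains C' where "C \<subseteq> C'" "maximal_clique C'"
proof -
  have bd: "\<forall>B. clique B \<and> C \<subseteq> B \<longrightarrow> card B \<le> card X"
    using finite_X by (auto simp: clique_def intro: card_mono)
  obtain B where B: "clique B" "C \<subseteq> B" "\<And>B'. clique B' \<Longrightarrow> C \<subseteq> B' \<Longrightarrow> card B' \<le> card B"
    using ex_has_greatest_nat[of "\<lambda>B. clique B \<and> C \<subseteq> B" C card "Suc (card X)"] assms bd by (auto simp: less_Suc_eq_le)
  have "maximal_clique B"
  proof (rule ccontr)
    assume "\<not> ?thesis"
    then obtain v where v: "v \<in> X - B" "\<forall>u\<in>B. adj v u" using B by (auto simp: maximal_clique_def)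
    then have "clique (insert v B)" using B(1) by (auto simp: clique_def dest: adj_sym)
    from B(3)[OF this] B(2) have "card (insert v B) \<le> card B" by auto
    moreover have "finite B" using B(1) finite_X by (auto simp: clique_def intro: finite_subset)
    ultimately show False using v by simp
  qed
  then show ?thesis using that B by blast
qed

text \<open>The edges leaving \<open>C\<close> are counted twice: each vertex of \<open>C\<close> is
  on \<open>a + 1 - card C\<close> of them, each outside vertex on at most \<open>p\<close>.
  Maximality supplies the non-neighbour that \<open>clique_nbrs_card_le\<close> asks for.\<close>

lemma maximal_clique_edge_count:
  assumes C: "maximal_clique C" "M + p * (p + 1) < card C"
    and reg: "\<And>z. z \<in> C \<Longrightarrow> card {v \<in> X. adj z v} = a"
  shows "real (card C) * (real a + 1 - card C) \<le> real p * (real (card X) - card C)"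
proof -
  have cl: "clique C" and CX: "C \<subseteq> X" using C by (auto simp: maximal_clique_def clique_def)
  have fC: "finite C" using CX finite_X finite_subset by blast
  have deg: "card {v \<in> X - C. adj z v} + card C = a + 1" if z: "z \<in> C" for z
  proof -
    have "{v \<in> X. adj z v} = {v \<in> X - C. adj z v} \<union> (C - {z})"
      using z cl CX by (auto simp: clique_def adj_irrefl)
    then have "a = card ({v \<in> X - C. adj z v} \<union> (C - {z}))" using reg[OF z] by simp
    also have "\<dots> = card {v \<in> X - C. adj z v} + card (C - {z})"
      using fC finite_X by (intro card_Un_disjoint) auto
    finally show ?thesis using z fC card_gt_0_iff[of C] by (auto simp: card_Diff_singleton)
  qed
  have "(\<Sum>z\<in>C. real (card {v \<in> X - C. adj z v})) = (\<Sum>z\<in>C. real a + 1 - card C)"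
  proof (rule sum.cong[OF refl])
    fix z assume "z \<in> C"
    from deg[OF this] show "real (card {v \<in> X - C. adj z v}) = real a + 1 - card C" by linarith
  qed
  then have "real (card C) * (real a + 1 - card C) = (\<Sum>z\<in>C. real (card {v \<in> X - C. adj z v}))" by simp
  also have "\<dots> = (\<Sum>z\<in>C. \<Sum>v\<in>X - C. if adj z v then 1 else 0)"
    using finite_X by (simp add: sum.If_cases Int_def)
  also have "\<dots> = (\<Sum>v\<in>X - C. \<Sum>z\<in>C. if adj v z then 1 else 0)"
    by (subst sum.swap) (simp add: adj_commute)
  also have "\<dots> = (\<Sum>v\<in>X - C. real (card {z \<in> C. adj v z}))"
    using fC by (simp add: sum.If_cases Int_def)
  also have "\<dots> \<le> (\<Sum>v\<in>X - C. real p)"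
    using clique_nbrs_card_le[OF cl C(2)] C(1)
    unfolding maximal_clique_def by (intro sum_mono) (meson of_nat_mono)
  also have "\<dots> = real p * (real (card X) - card C)"
    using finite_X fC CX by (simp add: card_Diff_subset card_mono of_nat_diff)
  finally show ?thesis .
qed

text \<open>For a maximum coclique \<open>S\<close> among the neighbours of \<open>y\<close>, the
  set \<open>Q z\<close> consists of \<open>z\<close> and the vertices whose only neighbour in
  \<open>S\<close> is \<open>z\<close>. These sets are cliques, at most \<open>m\<close> of them
  have \<open>L\<close> or more elements, and all remaining vertices lie in some \<open>R T\<close>,
  the common neighbours of a pair from \<open>S\<close>. The three terms of the bound are the large
  cliques, an allowance of \<open>L\<close> for each element of \<open>S\<close>, and the
  pairs.\<close>

lemma valency_le:
  fixes N :: real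
  defines "L \<equiv> M + p * (p + 1) + 1"
  assumes y: "y \<in> X" and M: "M \<ge> m * (p + 1)" and N: "N \<ge> 0"
    and big: "\<And>C. maximal_clique C \<Longrightarrow> y \<in> C \<Longrightarrow> L < card C \<Longrightarrow> card C \<le> N"
  shows "card {v \<in> X. adj y v} \<le> m * N + real (m\<^sup>2 * L + (m\<^sup>2 choose 2) * M)"
proof -
  define Y where "Y = {v \<in> X. adj y v}"
  have fY: "finite Y" using finite_X by (simp add: Y_def)
  have YX: "Y \<subseteq> X" by (auto simp: Y_def)
  define indep where "indep S \<longleftrightarrow> S \<subseteq> Y \<and> (\<forall>u\<in>S. \<forall>v\<in>S. \<not> adj u v)" for S
  have "\<forall>S. indep S \<longrightarrow> card S \<le> card Y" using fY by (auto simp: indep_def intro: card_mono)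
  moreover have "indep {}" by (simp add: indep_def)
  ultimately obtain S where S: "indep S" and Smax: "\<And>S'. indep S' \<Longrightarrow> card S' \<le> card S"
    using ex_has_greatest_nat[of indep "{}" card "Suc (card Y)"] by (auto simp: less_Suc_eq_le)
  have SY: "S \<subseteq> Y" using S by (simp add: indep_def)
  have fS: "finite S" using SY fY finite_subset by blast
  have cS: "card S \<le> m\<^sup>2" by (rule coclique_card_le[OF y]) (use S in \<open>auto simp: indep_def Y_def\<close>)
  define Q where "Q z = {v \<in> Y. v = z \<or> adj v z \<and> (\<forall>z'\<in>S - {z}. \<not> adj v z')}" for z
  define R where "R T = {v \<in> X. \<forall>z\<in>T. adj z v}" for T
  define Pairs where "Pairs = {T. T \<subseteq> S \<and> card T = 2}"
  have fPairs: "finite Pairs" unfolding Pairs_def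
    by (rule finite_subset[of _ "Pow S"]) (use fS in auto)
  have Qadj: "\<And>v z z'. z \<in> S \<Longrightarrow> v \<in> Q z \<Longrightarrow> z' \<in> S \<Longrightarrow> z' \<noteq> z \<Longrightarrow> \<not> adj v z' \<and> v \<noteq> z'"
    using S by (auto simp: Q_def indep_def dest: adj_sym)
  have Qcl: "adj u v" if z: "z \<in> S" and uv: "u \<in> Q z" "v \<in> Q z" "u \<noteq> v" for u v z
  proof (rule ccontr)
    assume n: "\<not> adj u v"
    have n': "\<not> adj v u" using n adj_sym by blast
    have ne: "u \<noteq> z" "v \<noteq> z" using uv n n' unfolding Q_def by blast+
    have nS: "u \<notin> S" "v \<notin> S" using uv z ne S unfolding Q_def indep_def by blast+
    \<comment> \<open>Exchanging \<open>z\<close> for two non-adjacent elements of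
      \<open>Q z\<close> would enlarge the coclique.\<close>
    have "indep (insert u (insert v (S - {z})))"
    proof -
      have "\<not> adj u x \<and> \<not> adj x u \<and> \<not> adj v x \<and> \<not> adj x v" if "x \<in> S - {z}" for x
        using uv(1,2) ne that adj_commute unfolding Q_def by blast
      moreover have "\<not> adj x x'" if "x \<in> S" "x' \<in> S" for x x' using S that unfolding indep_def by blast
      ultimately show ?thesis
        using uv(1,2) SY n n' adj_irrefl unfolding indep_def Q_def by blast
    qed
    from Smax[OF this] have "card (insert u (insert v (S - {z}))) \<le> card S" .
    moreover have "card S > 0" using z fS card_gt_0_iff by blast
    ultimately show False using uv(3) nS fS z by simp
  qed
  have QY: "Q z \<subseteq> Y" for z by (auto simp: Q_def)
  have fQ: "finite (Q z)" for z using QY fY finite_subset by blast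
  have cover: "Y \<subseteq> (\<Union>z\<in>S. Q z) \<union> (\<Union>T\<in>Pairs. R T)"
  proof
    fix v assume v: "v \<in> Y"
    show "v \<in> (\<Union>z\<in>S. Q z) \<union> (\<Union>T\<in>Pairs. R T)"
    proof (cases "v \<in> S \<or> (\<exists>z\<in>S. v \<in> Q z)")
      case True then show ?thesis using v by (auto simp: Q_def)
    next
      case False
      \<comment> \<open>Maximality of \<open>S\<close> gives one neighbour in \<open>S\<close>;
        being outside \<open>Q z\<close> then gives a second.\<close>
      have "\<exists>z\<in>S. adj v z"
      proof (rule ccontr)
        assume "\<not> ?thesis"
        then have "indep (insert v S)" using v S by (auto simp: indep_def adj_irrefl dest: adj_sym)
        from Smax[OF this] False fS show False by simp
      qed
      then obtain z where z: "z \<in> S" "adj v z" by blast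
      then obtain z' where z': "z' \<in> S" "z' \<noteq> z" "adj v z'" using False v by (auto simp: Q_def)
      then have "{z, z'} \<in> Pairs" using z by (auto simp: Pairs_def)
      moreover have "v \<in> R {z, z'}" using z z' v YX by (auto simp: R_def dest: adj_sym)
      ultimately show ?thesis by blast
    qed
  qed
  have Rle: "card (R T) \<le> M" if T: "T \<in> Pairs" for T
  proof -
    obtain z z' where T: "T = {z, z'}" "z \<noteq> z'" "z \<in> S" "z' \<in> S"
      using T by (auto simp: Pairs_def card_2_iff)
    have "card {v \<in> X. adj z v \<and> adj z' v} \<le> M"
      by (rule common_nbrs) (use T S YX in \<open>auto simp: indep_def\<close>)
    then show ?thesis by (simp add: R_def T)
  qed
  define Bg where "Bg = {z \<in> S. L \<le> card (Q z)}"
  have qclique: "clique (insert y (Q z))" if "z \<in> S" for z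
    using Qcl[OF that] QY[of z] y by (auto simp: clique_def Y_def dest: adj_sym)
  have yQ: "y \<notin> Q z" for z using QY[of z] adj_irrefl by (auto simp: Y_def)
  have cBg: "card Bg \<le> m"
  proof (rule ccontr)
    assume "\<not> ?thesis"
    then obtain I where I: "I \<subseteq> Bg" "card I = m + 1"
      by (metis Suc_eq_plus1 not_less_eq_eq obtain_subset_with_card_n)
    \<comment> \<open>The large cliques are cut down to the common size \<open>L\<close> to fit
      \<open>separated_nbrs_card_le\<close>.\<close>
    have "\<forall>z\<in>I. \<exists>P\<subseteq>Q z. card P = L"
    proof
      fix z assume "z \<in> I"
      then have "L \<le> card (Q z)" using I by (auto simp: Bg_def)
      then show "\<exists>P\<subseteq>Q z. card P = L" by (metis obtain_subset_with_card_n)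
    qed
    then obtain P where P: "\<And>z. z \<in> I \<Longrightarrow> P z \<subseteq> Q z \<and> card (P z) = L" by metis
    have IS: "I \<subseteq> S" using I by (auto simp: Bg_def)
    have "L \<le> m\<^sup>2 * (p + 1)"
    proof (rule separated_nbrs_card_le[OF y I(2), of P])
      fix z z' assume zz: "z \<in> I" "z' \<in> I" "z \<noteq> z'"
      have "Q z \<inter> Q z' = {}" 
      proof -
        have "v \<notin> Q z'" if "v \<in> Q z" for v
          using Qadj[of z v z'] that zz IS unfolding Q_def by blast
        then show ?thesis by blast
      qed
      then show "P z \<inter> P z' = {}" using P zz by blast
      fix v assume v: "v \<in> P z"
      then have vQ: "v \<in> Q z" using P zz by auto
      have z'Q: "z' \<in> Q z'" using zz IS SY by (auto simp: Q_def)
      have vz: "\<not> adj v z'" "v \<noteq> z'" using Qadj[of z v z'] zz IS vQ by blast+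
      have vX: "v \<in> X - insert y (Q z')"
        using vQ yQ \<open>Q z \<inter> Q z' = {}\<close> QY[of z] YX by blast
      \<comment> \<open>The element \<open>z'\<close> of the clique serves as the non-neighbour of
        \<open>v\<close>.\<close>
      have "card {u \<in> insert y (Q z'). adj v u} \<le> p"
      proof (rule clique_nbrs_card_le[OF qclique _ vX _ vz(1)])
        show "M + p * (p + 1) < card (insert y (Q z'))"
          using I zz fQ yQ by (auto simp: Bg_def L_def)
      qed (use z'Q zz IS in auto)
      moreover have "card {u \<in> P z'. adj v u} \<le> card {u \<in> insert y (Q z'). adj v u}"
        by (rule card_mono) (use P[OF zz(2)] fQ[of z'] in auto)
      ultimately show "card {u \<in> P z'. adj v u} \<le> p" by (rule order_trans[rotated])
    next
      fix z assume "z \<in> I"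
      then show "P z \<subseteq> {v \<in> X. adj y v}" "card (P z) = L" using P[of z] QY[of z] by (auto simp: Y_def)
    qed
    moreover have "m\<^sup>2 * (p + 1) < L"
    proof -
      \<comment> \<open>Since \<open>p + m\<close> = m^2, the hypothesis on \<open>M\<close> makes
        \<open>L\<close> exceed the bound for separated sets.\<close>
      have "p * (p + 1) + m * (p + 1) = m\<^sup>2 * (p + 1)"
        using m_pos unfolding p_def by (cases m) (auto simp: algebra_simps power2_eq_square)
      then show ?thesis using M by (simp add: L_def)
    qed
    ultimately show False by simp
  qed
  have Qle: "real (card (Q z)) \<le> (if z \<in> Bg then N else 0) + L" if z: "z \<in> S" for z
  proof (cases "z \<in> Bg")
    case True
    \<comment> \<open>Adjoining \<open>y\<close> makes the clique strictly larger than
      \<open>Q z\<close>, so \<open>big\<close> applies even when \<open>Q z\<close> has exactly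
      \<open>L\<close> elements.\<close>
    obtain C where C: "insert y (Q z) \<subseteq> C" "maximal_clique C"
      using clique_extend_maximal qclique[OF z] by blast
    have "finite C" using C finite_X by (auto simp: maximal_clique_def clique_def intro: finite_subset)
    then have "card (insert y (Q z)) \<le> card C" using C card_mono by blast
    then have c: "card (Q z) < card C" using fQ yQ by simp
    then have "L < card C" using True by (simp add: Bg_def)
    from big[OF C(2) _ this] C(1) c True show ?thesis by auto
  qed (use z in \<open>auto simp: Bg_def\<close>)
  have "card Y \<le> card ((\<Union>z\<in>S. Q z) \<union> (\<Union>T\<in>Pairs. R T))"
    using cover fS fQ fPairs finite_X by (intro card_mono) (auto simp: R_def)
  also have "\<dots> \<le> (\<Sum>z\<in>S. card (Q z)) + (\<Sum>T\<in>Pairs. card (R T))"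
    by (rule order_trans[OF card_Un_le]) (intro add_mono card_UN_le fS fPairs)
  finally have "real (card Y) \<le> (\<Sum>z\<in>S. real (card (Q z))) + (\<Sum>T\<in>Pairs. real (card (R T)))"
    unfolding of_nat_sum[symmetric] of_nat_add[symmetric] of_nat_le_iff .
  also have "(\<Sum>z\<in>S. real (card (Q z))) \<le> (\<Sum>z\<in>S. (if z \<in> Bg then N else 0) + L)"
    by (rule sum_mono) (rule Qle)
  also have "\<dots> = card Bg * N + card S * L"
  proof -
    have "S \<inter> {z. z \<in> Bg} = Bg" by (auto simp: Bg_def)
    then show ?thesis using fS by (simp add: sum.distrib sum.If_cases)
  qed
  also have "\<dots> \<le> m * N + m\<^sup>2 * L"
    using cBg N by (intro add_mono mult_right_mono of_nat_mono mult_le_mono1 cS) auto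
  also have "(\<Sum>T\<in>Pairs. real (card (R T))) \<le> (\<Sum>T\<in>Pairs. real M)"
    by (rule sum_mono) (use Rle in simp)
  also have "\<dots> = (card S choose 2) * M" using n_subsets[OF fS, of 2] by (simp add: Pairs_def)
  also have "\<dots> \<le> (m\<^sup>2 choose 2) * M"
    using cS by (intro of_nat_mono mult_right_mono binomial_right_mono) auto
  finally show ?thesis by (simp add: Y_def)
qed

end

section \<open>Distance-regular graphs and cosine sequences\<close>

text \<open>Distances are natural numbers and \<open>c_card\<close> uses
  \<open>Suc (d x z) = d x y\<close> rather than a truncated subtraction, so that the set is empty
  at distance 0 and \<open>c 0\<close> vanishes.\<close>

locale distance_regular_metric =
  fixes V :: "'a set" and adj :: "'a \<Rightarrow> 'a \<Rightarrow> bool" and d :: "'a \<Rightarrow> 'a \<Rightarrow> nat"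
    and D :: nat and b c :: "nat \<Rightarrow> real"
  assumes finite_V: "finite V"
    and adj_V: "adj x y \<Longrightarrow> x \<in> V \<and> y \<in> V"
    and adj_sym: "adj x y \<Longrightarrow> adj y x"
    and d_sym: "\<lbrakk>x \<in> V; y \<in> V\<rbrakk> \<Longrightarrow> d x y = d y x"
    and d_eq_0: "\<lbrakk>x \<in> V; y \<in> V\<rbrakk> \<Longrightarrow> d x y = 0 \<longleftrightarrow> x = y"
    and d_eq_1: "\<lbrakk>x \<in> V; y \<in> V\<rbrakk> \<Longrightarrow> d x y = 1 \<longleftrightarrow> adj x y"
    and d_le: "\<lbrakk>x \<in> V; y \<in> V\<rbrakk> \<Longrightarrow> d x y \<le> D"
    and d_step: "\<lbrakk>x \<in> V; adj y z\<rbrakk> \<Longrightarrow> d x z \<le> Suc (d x y)"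
    and d_pred: "\<lbrakk>x \<in> V; y \<in> V; d x y = Suc i\<rbrakk> \<Longrightarrow> \<exists>z. adj y z \<and> d x z = i"
    and d_attained: "i \<le> D \<Longrightarrow> \<exists>x\<in>V. \<exists>y\<in>V. d x y = i"
    and c_card: "\<lbrakk>x \<in> V; y \<in> V\<rbrakk> \<Longrightarrow> real (card {z. adj y z \<and> Suc (d x z) = d x y}) = c (d x y)"
    and b_card: "\<lbrakk>x \<in> V; y \<in> V\<rbrakk> \<Longrightarrow> real (card {z. adj y z \<and> d x z = Suc (d x y)}) = b (d x y)"
begin

definition a :: "nat \<Rightarrow> real" where "a i = b 0 - c i - b i"

lemma finite_nbrs: "finite {z. adj y z \<and> P z}"
  by (rule finite_subset[OF _ finite_V]) (use adj_V in auto)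

lemma valency:
  assumes "y \<in> V"
  shows "real (card {z. adj y z}) = b 0"
proof -
  have "{z. adj y z} = {z. adj y z \<and> d y z = Suc (d y y)}"
    using d_eq_1 d_eq_0 adj_V by fastforce
  then show ?thesis using b_card[of y y] d_eq_0[of y y] assms by simp
qed

lemma c_pos:
  assumes "i \<le> D" "0 < i"
  shows "c i > 0"
proof -
  obtain x y where xy: "x \<in> V" "y \<in> V" "d x y = i" using d_attained assms by blast
  obtain j where j: "i = Suc j" using assms(2) by (cases i) auto
  then obtain z where "adj y z" "d x z = j" using d_pred xy by blast
  then have "{z. adj y z \<and> Suc (d x z) = d x y} \<noteq> {}" using j xy by auto
  then have "card {z. adj y z \<and> Suc (d x z) = d x y} > 0" by (simp add: card_gt_0_iff finite_nbrs)
  then show "c i > 0" using c_card[OF xy(1,2)] xy(3) by simp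
qed

lemma a_card:
  assumes "x \<in> V" "y \<in> V"
  shows "real (card {z. adj y z \<and> d x z = d x y}) = a (d x y)"
proof -
  let ?B = "{z. adj y z \<and> d x z = Suc (d x y)}" and ?C = "{z. adj y z \<and> Suc (d x z) = d x y}"
    and ?A = "{z. adj y z \<and> d x z = d x y}"
  have "d x z = Suc (d x y) \<or> Suc (d x z) = d x y \<or> d x z = d x y" if "adj y z" for z
    using d_step[OF assms(1) that] d_step[OF assms(1) adj_sym[OF that]] by linarith
  then have "{z. adj y z} = ?A \<union> (?B \<union> ?C)" by auto
  then have "card {z. adj y z} = card ?A + (card ?B + card ?C)"
    by (simp add: card_Un_disjoint finite_nbrs disjoint_iff)
  then show ?thesis using valency[OF assms(2)] b_card[OF assms] c_card[OF assms] by (simp add: a_def)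
qed

lemma a_nonneg: assumes "i \<le> D" shows "a i \<ge> 0"
  using d_attained[OF assms] a_card by (metis of_nat_0_le_iff)

text \<open>The neighbours of \<open>y\<close> are sorted by their distance from \<open>x\<close>.
  For \<open>d x y = 0\<close> the truncated index \<open>d x y - 1\<close> is harmless, because its
  coefficient \<open>c 0\<close> is zero.\<close>

lemma sum_nbrs_distance:
  assumes x: "x \<in> V" and y: "y \<in> V"
  shows "(\<Sum>z | adj y z. u (d x z)) = c (d x y) * u (d x y - 1) + a (d x y) * u (d x y) + b (d x y) * u (Suc (d x y))"
proof -
  let ?B = "{z. adj y z \<and> d x z = Suc (d x y)}" and ?C = "{z. adj y z \<and> Suc (d x z) = d x y}"
    and ?A = "{z. adj y z \<and> d x z = d x y}"
  have "d x z = Suc (d x y) \<or> Suc (d x z) = d x y \<or> d x z = d x y" if "adj y z" for z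
    using d_step[OF assms(1) that] d_step[OF assms(1) adj_sym[OF that]] by linarith
  then have "{z. adj y z} = ?A \<union> (?B \<union> ?C)" by auto
  then have "(\<Sum>z | adj y z. u (d x z)) = (\<Sum>z\<in>?A. u (d x z)) + ((\<Sum>z\<in>?B. u (d x z)) + (\<Sum>z\<in>?C. u (d x z)))"
    by (simp add: sum.union_disjoint finite_nbrs disjoint_iff)
  moreover have "(\<Sum>z\<in>?A. u (d x z)) = (\<Sum>z\<in>?A. u (d x y))" by (rule sum.cong) auto
  moreover have "(\<Sum>z\<in>?B. u (d x z)) = (\<Sum>z\<in>?B. u (Suc (d x y)))" by (rule sum.cong) auto
  moreover have "(\<Sum>z\<in>?C. u (d x z)) = (\<Sum>z\<in>?C. u (d x y - 1))"
    by (rule sum.cong) (auto intro: arg_cong[where f=u])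
  ultimately show ?thesis using a_card[OF x y] b_card[OF x y] c_card[OF x y] by simp
qed

section \<open>Eigenfunctions and cosine matrices\<close>

definition eigenfunction :: "real \<Rightarrow> ('a \<Rightarrow> real) \<Rightarrow> bool" where
  "eigenfunction \<theta> g \<longleftrightarrow> (\<forall>y\<in>V. (\<Sum>z | adj y z. g z) = \<theta> * g y)"

definition sphere_sum :: "('a \<Rightarrow> real) \<Rightarrow> nat \<Rightarrow> 'a \<Rightarrow> real" where
  "sphere_sum g i x = (\<Sum>v | v \<in> V \<and> d x v = i. g v)"

lemma sphere_sum_0:
  assumes "x \<in> V"
  shows "sphere_sum g 0 x = g x"
proof -
  have "{v. v \<in> V \<and> d x v = 0} = {x}" using d_eq_0 assms by auto
  then show ?thesis by (simp add: sphere_sum_def)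
qed

text \<open>This is the three-term recurrence of the distance matrices applied to \<open>g\<close>.
  After swapping sums, \<open>g z\<close> is counted once for each neighbour of \<open>z\<close> at
  distance \<open>i\<close> from \<open>x\<close>: there are \<open>c (Suc i)\<close>,
  \<open>a i\<close> or \<open>b (i - 1)\<close> of these for \<open>z\<close> at distance i + 1, i
  or i - 1, and none otherwise.\<close>

lemma sphere_sum_recurrence:
  assumes g: "eigenfunction \<theta> g" and x: "x \<in> V"
  shows "\<theta> * sphere_sum g i x = c (Suc i) * sphere_sum g (Suc i) x + a i * sphere_sum g i x
    + (if i = 0 then 0 else b (i - 1) * sphere_sum g (i - 1) x)"
proof -
  have S: "sphere_sum g j x = (\<Sum>v\<in>V. if d x v = j then g v else 0)" for j
    using finite_V by (simp add: sphere_sum_def sum.If_cases Int_def conj_commute)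
  have "\<theta> * sphere_sum g i x = (\<Sum>v\<in>V. if d x v = i then (\<Sum>z | adj v z. g z) else 0)"
    unfolding S sum_distrib_left by (rule sum.cong) (use g in \<open>auto simp: eigenfunction_def\<close>)
  also have "\<dots> = (\<Sum>v\<in>V. \<Sum>z\<in>V. if adj v z \<and> d x v = i then g z else 0)"
  proof (rule sum.cong[OF refl])
    fix v assume "v \<in> V"
    have "{z. adj v z} = {z \<in> V. adj v z}" using adj_V by auto
    then show "(if d x v = i then (\<Sum>z | adj v z. g z) else 0)
        = (\<Sum>z\<in>V. if adj v z \<and> d x v = i then g z else 0)"
      using finite_V by (simp add: sum.If_cases Int_def)
  qed
  also have "\<dots> = (\<Sum>z\<in>V. \<Sum>v\<in>V. if adj v z \<and> d x v = i then g z else 0)" by (rule sum.swap)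
  also have "\<dots> = (\<Sum>z\<in>V. g z * card {v. adj z v \<and> d x v = i})"
  proof (rule sum.cong[OF refl])
    fix z
    have "{v \<in> V. adj v z \<and> d x v = i} = {v. adj z v \<and> d x v = i}" using adj_V adj_sym by blast
    then show "(\<Sum>v\<in>V. if adj v z \<and> d x v = i then g z else 0) = g z * card {v. adj z v \<and> d x v = i}"
      using finite_V by (simp add: sum.If_cases Int_def)
  qed
  also have "\<dots> = (\<Sum>z\<in>V. (c (Suc i) * (if d x z = Suc i then g z else 0)
      + a i * (if d x z = i then g z else 0))
      + (if i = 0 then 0 else b (i - 1) * (if d x z = i - 1 then g z else 0)))"
  proof (rule sum.cong[OF refl])
    fix z assume z: "z \<in> V"
    consider "d x z = Suc i" | "d x z = i" | "Suc (d x z) = i"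
      | "d x z \<noteq> Suc i" "d x z \<noteq> i" "Suc (d x z) \<noteq> i" by blast
    then show "g z * card {v. adj z v \<and> d x v = i} = (c (Suc i) * (if d x z = Suc i then g z else 0)
      + a i * (if d x z = i then g z else 0))
      + (if i = 0 then 0 else b (i - 1) * (if d x z = i - 1 then g z else 0))"
    proof cases
      case 1
      then have "d x z \<noteq> i - 1" by simp
      then show ?thesis using 1 c_card[OF x z] by simp
    next
      case 2 then show ?thesis using a_card[OF x z] by auto
    next
      case 3 then show ?thesis using b_card[OF x z] by auto
    next
      case 4
      have "\<not> (adj z v \<and> d x v = i)" for v
        using d_step[OF x, of z v] d_step[OF x, of v z] adj_sym[of z v] 4 by linarith
      then have "{v. adj z v \<and> d x v = i} = {}" by blast
      then have "g z * card {v. adj z v \<and> d x v = i} = 0" by (simp only: card.empty)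
      moreover have "i = 0 \<or> d x z \<noteq> i - 1" using 4 by arith
      ultimately show ?thesis using 4 by auto
    qed
  qed
  also have "\<dots> = c (Suc i) * sphere_sum g (Suc i) x + a i * sphere_sum g i x
    + (if i = 0 then 0 else b (i - 1) * sphere_sum g (i - 1) x)"
    unfolding S by (simp add: sum.distrib sum_distrib_left)
  finally show ?thesis .
qed

text \<open>Distance matrices are polynomials in the adjacency matrix, so they act on eigenfunctions
  by a scalar. The quantifier order matters: the scalar depends on \<theta> and \<open>i\<close>
  only. Up to \<open>D\<close> the recurrence is solved by dividing by \<open>c i\<close>; beyond
  \<open>D\<close> the spheres are empty.\<close>

lemma sphere_sum_eigenfunction:
  "\<exists>p. \<forall>g x. eigenfunction \<theta> g \<longrightarrow> x \<in> V \<longrightarrow> sphere_sum g i x = p * g x"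
proof (induction i rule: less_induct)
  case (less i)
  show ?case
  proof (cases i)
    case 0
    then show ?thesis by (intro exI[of _ 1]) (simp add: sphere_sum_0)
  next
    case (Suc j)
    show ?thesis
    proof (cases "i \<le> D")
      case False
      have "sphere_sum g i x = 0" if "x \<in> V" for g x
        unfolding sphere_sum_def by (rule sum.neutral) (use d_le[OF that] False in auto)
      then show ?thesis by (intro exI[of _ 0]) simp
    next
      case True
      have cn: "c i \<noteq> 0" using c_pos[OF True] Suc by simp
      obtain p where p: "\<And>g x. eigenfunction \<theta> g \<Longrightarrow> x \<in> V \<Longrightarrow> sphere_sum g j x = p * g x"
        using less.IH[of j] Suc by auto
      obtain p' where p': "\<And>g x. eigenfunction \<theta> g \<Longrightarrow> x \<in> V \<Longrightarrow>
          (if j = 0 then 0 else b (j - 1) * sphere_sum g (j - 1) x) = p' * g x"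
      proof (cases "j = 0")
        case False
        obtain r where "\<And>g x. eigenfunction \<theta> g \<Longrightarrow> x \<in> V \<Longrightarrow> sphere_sum g (j - 1) x = r * g x"
          using less.IH[of "j - 1"] Suc by (metis diff_le_self le_imp_less_Suc)
        then show ?thesis using that[of "b (j - 1) * r"] False by simp
      qed (use that[of 0] in simp)
      have "sphere_sum g i x = ((\<theta> - a j) * p - p') / c i * g x" if "eigenfunction \<theta> g" "x \<in> V" for g x
        using sphere_sum_recurrence[OF that, of j] p[OF that] p'[OF that] cn Suc by (simp add: field_simps)
      then show ?thesis by blast
    qed
  qed
qed

lemma sum_V_by_distance:
  assumes "x \<in> V"
  shows "(\<Sum>z\<in>V. f (d x z) * g z) = (\<Sum>i\<le>D. f i * sphere_sum g i x)"
proof -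
  have "(\<Sum>z\<in>V. f (d x z) * g z) = (\<Sum>i\<le>D. \<Sum>z | z \<in> V \<and> d x z = i. f (d x z) * g z)"
    by (rule sum.group[symmetric]) (use finite_V d_le[OF assms] in auto)
  also have "\<dots> = (\<Sum>i\<le>D. f i * sphere_sum g i x)"
    unfolding sphere_sum_def sum_distrib_left by (intro sum.cong refl) auto
  finally show ?thesis .
qed

text \<open>
  The matrix \<open>E\<close> with entries \<open>u (d x y)\<close> has eigenfunctions of the adjacency matrix as columns.
  Since \<open>E\<close> is itself a combination of distance matrices, \<open>E\<^sup>2\<close> is a multiple of \<open>E\<close>, and the
  diagonal shows that the factor is positive.
\<close>

lemma cosine_matrix_psd:
  fixes u :: "nat \<Rightarrow> real"
  assumes u0: "u 0 = 1"
    and rec: "\<And>i. i \<le> D \<Longrightarrow> c i * u (i - 1) + a i * u i + b i * u (Suc i) = \<theta> * u i"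
    and A: "A \<subseteq> V"
  shows "0 \<le> (\<Sum>x\<in>A. \<Sum>y\<in>A. w x * w y * u (d x y))"
proof -
  have eig: "eigenfunction \<theta> (\<lambda>z. u (d z y))" if y: "y \<in> V" for y
    unfolding eigenfunction_def
  proof
    fix z assume z: "z \<in> V"
    have "(\<Sum>v | adj z v. u (d v y)) = (\<Sum>v | adj z v. u (d y v))"
      by (rule sum.cong) (use adj_V d_sym y in auto)
    also have "\<dots> = \<theta> * u (d z y)"
      using sum_nbrs_distance[OF y z, of u] rec d_le[OF y z] d_sym[OF y z] by simp
    finally show "(\<Sum>v | adj z v. u (d v y)) = \<theta> * u (d z y)" .
  qed
  obtain p where p: "\<And>i g x. eigenfunction \<theta> g \<Longrightarrow> x \<in> V \<Longrightarrow> sphere_sum g i x = p i * g x"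
    using sphere_sum_eigenfunction[of \<theta>] by metis
  \<comment> \<open>The factor with E^2 = s E.\<close>
  define s where "s = (\<Sum>i\<le>D. u i * p i)"
  have EE: "(\<Sum>z\<in>V. u (d z x) * u (d z y)) = s * u (d x y)" if x: "x \<in> V" and y: "y \<in> V" for x y
  proof -
    have "(\<Sum>z\<in>V. u (d z x) * u (d z y)) = (\<Sum>z\<in>V. u (d x z) * u (d z y))"
      by (rule sum.cong) (use d_sym x in auto)
    also have "\<dots> = (\<Sum>i\<le>D. u i * sphere_sum (\<lambda>z. u (d z y)) i x)"
      by (rule sum_V_by_distance[OF x])
    also have "\<dots> = s * u (d x y)"
      unfolding s_def sum_distrib_right by (simp add: p[OF eig[OF y] x] mult.assoc)
    finally show ?thesis .
  qed
  obtain x where x: "x \<in> V" using d_attained[of 0] by blast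
  have "1 = (u (d x x))\<^sup>2" using u0 d_eq_0[of x x] x by simp
  also have "\<dots> \<le> (\<Sum>z\<in>V. (u (d z x))\<^sup>2)"
    by (rule member_le_sum[OF x, of "\<lambda>z. (u (d z x))\<^sup>2"]) (use finite_V in auto)
  also have "\<dots> = s" using EE[OF x x] u0 d_eq_0[of x x] x by (simp add: power2_eq_square)
  finally have s: "s \<ge> 1" .
  \<comment> \<open>With h = E w, the square norm of h is the form of E^2, that is, \<open>s\<close>
    times the form of E.\<close>
  define h where "h z = (\<Sum>x\<in>A. w x * u (d z x))" for z
  have "0 \<le> (\<Sum>z\<in>V. (h z)\<^sup>2)" by (simp add: sum_nonneg)
  also have "\<dots> = (\<Sum>z\<in>V. \<Sum>x\<in>A. \<Sum>y\<in>A. w x * w y * (u (d z x) * u (d z y)))"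
    unfolding h_def power2_eq_square sum_product by (simp add: algebra_simps)
  also have "\<dots> = (\<Sum>x\<in>A. \<Sum>z\<in>V. \<Sum>y\<in>A. w x * w y * (u (d z x) * u (d z y)))" by (rule sum.swap)
  also have "\<dots> = (\<Sum>x\<in>A. \<Sum>y\<in>A. \<Sum>z\<in>V. w x * w y * (u (d z x) * u (d z y)))"
    by (rule sum.cong[OF refl]) (rule sum.swap)
  also have "\<dots> = (\<Sum>x\<in>A. \<Sum>y\<in>A. w x * w y * (s * u (d x y)))"
  proof (intro sum.cong refl)
    fix x y assume "x \<in> A" "y \<in> A"
    then show "(\<Sum>z\<in>V. w x * w y * (u (d z x) * u (d z y))) = w x * w y * (s * u (d x y))"
      using EE[of x y] A unfolding sum_distrib_left[symmetric] by (simp add: subset_iff)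
  qed
  also have "\<dots> = s * (\<Sum>x\<in>A. \<Sum>y\<in>A. w x * w y * u (d x y))"
    unfolding sum_distrib_left by (intro sum.cong refl) simp
  finally show ?thesis using s by (simp add: zero_le_mult_iff)
qed

text \<open>The cosine matrix is tested on the characteristic vector of the clique, where all row
  sums agree.\<close>

lemma clique_form:
  assumes u0: "u 0 = 1"
    and rec: "\<And>i. i \<le> D \<Longrightarrow> c i * u (i - 1) + a i * u i + b i * u (Suc i) = \<theta> * u i"
    and C: "C \<subseteq> V" "C \<noteq> {}" "\<And>x y. x \<in> C \<Longrightarrow> y \<in> C \<Longrightarrow> x \<noteq> y \<Longrightarrow> adj x y"
  shows "0 \<le> 1 + (real (card C) - 1) * u 1"
proof -
  have fC: "finite C" using C finite_V finite_subset by blast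
  have cC: "card C > 0" using fC C by (simp add: card_gt_0_iff)
  have row: "(\<Sum>y\<in>C. 1 * 1 * u (d x y)) = 1 + (real (card C) - 1) * u 1" if x: "x \<in> C" for x
  proof -
    have "(\<Sum>y\<in>C. 1 * 1 * u (d x y)) = u (d x x) + (\<Sum>y\<in>C - {x}. u (d x y))"
      using fC x by (simp add: sum.remove)
    also have "(\<Sum>y\<in>C - {x}. u (d x y)) = (\<Sum>y\<in>C - {x}. u 1)"
    proof (rule sum.cong[OF refl])
      fix y assume "y \<in> C - {x}"
      then have "d x y = 1" using C x d_eq_1[of x y] by blast
      then show "u (d x y) = u 1" by simp
    qed
    also have "\<dots> = (real (card C) - 1) * u 1" using x fC cC by (simp add: card_Diff_singleton of_nat_diff)
    finally show ?thesis using d_eq_0[of x x] x C u0 by auto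
  qed
  have "0 \<le> (\<Sum>x\<in>C. \<Sum>y\<in>C. 1 * 1 * u (d x y))"
    by (rule cosine_matrix_psd[OF u0 rec C(1)])
  also have "\<dots> = card C * (1 + (real (card C) - 1) * u 1)" by (simp add: row[simplified] cong: sum.cong)
  finally show ?thesis using cC by (simp add: zero_le_mult_iff)
qed

text \<open>Giving \<open>x\<close> the weight \<open>- u 1 * (\<Sum>y. w y)\<close> projects the local graph orthogonally to \<open>x\<close>.\<close>

lemma local_graph_least_eigenvalue:
  fixes u w m
  assumes u0: "u 0 = 1"
    and rec: "\<And>i. i \<le> D \<Longrightarrow> c i * u (i - 1) + a i * u i + b i * u (Suc i) = \<theta> * u i"
    and u: "u 2 < u 1" "u 2 \<le> (u 1)\<^sup>2" "1 - u 2 = m * (u 1 - u 2)"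
    and x: "x \<in> V"
  defines "X \<equiv> {y. adj x y}"
  shows "0 \<le> (\<Sum>y\<in>X. \<Sum>z\<in>X. if adj y z then w y * w z else 0) + m * (\<Sum>y\<in>X. (w y)\<^sup>2)"
proof -
  define F where "F = (\<Sum>y\<in>X. \<Sum>z\<in>X. if adj y z then w y * w z else 0)"
  define S2 where "S2 = (\<Sum>y\<in>X. (w y)\<^sup>2)"
  define s where "s = (\<Sum>y\<in>X. w y)"
  have fX: "finite X" using finite_nbrs[of x "\<lambda>_. True"] by (simp add: X_def)
  have irr: "\<not> adj y y" for y using d_eq_0[of y y] d_eq_1[of y y] adj_V[of y y] by auto
  have xX: "x \<notin> X" using irr by (simp add: X_def)
  have XV: "X \<subseteq> V" using adj_V by (auto simp: X_def)
  define w' where "w' y = (if y = x then - u 1 * s else w y)" for y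
  have w': "w' x = - u 1 * s" "\<And>y. y \<in> X \<Longrightarrow> w' y = w y" using xX by (auto simp: w'_def)
  have dx: "d x y = 1" "d y x = 1" if "y \<in> X" for y
    using that d_eq_1[of x y] d_eq_1[of y x] adj_V adj_sym x by (auto simp: X_def)
  have dX: "d y z = (if y = z then 0 else if adj y z then 1 else 2)" if yz: "y \<in> X" "z \<in> X" for y z
  proof -
    have V: "y \<in> V" "z \<in> V" using yz XV by auto
    have "d y z \<le> Suc (d y x)" using d_step[of y x z] yz V by (simp add: X_def)
    then have "d y z \<le> 2" using dx yz by simp
    then show ?thesis using d_eq_0[OF V] d_eq_1[OF V] by (auto simp: le_Suc_eq numeral_2_eq_2)
  qed
  have "0 \<le> (\<Sum>y\<in>insert x X. \<Sum>z\<in>insert x X. w' y * w' z * u (d y z))"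
    by (rule cosine_matrix_psd[OF u0 rec]) (use x XV in auto)
  also have "\<dots> = w' x * w' x * u (d x x) + (\<Sum>z\<in>X. w' x * w' z * u (d x z))
      + ((\<Sum>y\<in>X. w' y * w' x * u (d y x)) + (\<Sum>y\<in>X. \<Sum>z\<in>X. w' y * w' z * u (d y z)))"
    using fX xX by (simp add: sum.distrib)
  also have "(\<Sum>z\<in>X. w' x * w' z * u (d x z)) = - (u 1)\<^sup>2 * s\<^sup>2"
  proof -
    have "(\<Sum>z\<in>X. w' x * w' z * u (d x z)) = (\<Sum>z\<in>X. (- (u 1)\<^sup>2 * s) * w z)"
      by (rule sum.cong) (simp_all add: w' dx power2_eq_square)
    also have "\<dots> = (- (u 1)\<^sup>2 * s) * s" unfolding s_def by (rule sum_distrib_left[symmetric])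
    finally show ?thesis by (simp add: power2_eq_square)
  qed
  also have "(\<Sum>y\<in>X. w' y * w' x * u (d y x)) = - (u 1)\<^sup>2 * s\<^sup>2"
  proof -
    have "(\<Sum>z\<in>X. w' z * w' x * u (d z x)) = (\<Sum>z\<in>X. (- (u 1)\<^sup>2 * s) * w z)"
      by (rule sum.cong) (simp_all add: w' dx power2_eq_square)
    also have "\<dots> = (- (u 1)\<^sup>2 * s) * s" unfolding s_def by (rule sum_distrib_left[symmetric])
    finally show ?thesis by (simp add: power2_eq_square)
  qed
  also have "w' x * w' x * u (d x x) = (u 1)\<^sup>2 * s\<^sup>2"
    using d_eq_0[of x x] x u0 w' by (simp add: power2_eq_square)
  \<comment> \<open>Two neighbours of \<open>x\<close> are at distance at most 2, so on
    \<open>X\<close> the cosine matrix is u 2 J + (1 - u 2) I + (u 1 - u 2) A, with J the all-ones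
    matrix.\<close>
  also have "(\<Sum>y\<in>X. \<Sum>z\<in>X. w' y * w' z * u (d y z))
      = (\<Sum>y\<in>X. \<Sum>z\<in>X. u 2 * (w y * w z) + (if z = y then (1 - u 2) * (w y * w z) else 0)
          + (u 1 - u 2) * (if adj y z then w y * w z else 0))"
    by (intro sum.cong refl) (use w' dX u0 irr in \<open>auto simp: algebra_simps\<close>)
  also have "\<dots> = u 2 * s\<^sup>2 + (1 - u 2) * S2 + (u 1 - u 2) * F"
    using fX unfolding s_def S2_def F_def
    by (simp add: sum.distrib sum_distrib_left[symmetric] power2_eq_square sum_product)
  finally have "0 \<le> (u 2 - (u 1)\<^sup>2) * s\<^sup>2 + (1 - u 2) * S2 + (u 1 - u 2) * F"
    by (simp add: algebra_simps)
  moreover have "(u 2 - (u 1)\<^sup>2) * s\<^sup>2 \<le> 0" using u(2) by (simp add: mult_nonpos_nonneg)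
  ultimately have "0 \<le> (1 - u 2) * S2 + (u 1 - u 2) * F" by linarith
  also have "\<dots> = (u 1 - u 2) * (F + m * S2)" unfolding u(3) by (simp add: algebra_simps)
  finally show ?thesis using u(1) unfolding F_def[symmetric] S2_def[symmetric] by (simp add: zero_le_mult_iff)
qed

end

section \<open>The distance function of a symmetric digraph\<close>

text \<open>A natural-valued distance, meaningful only for vertices joined by a walk. Relation
  powers allow induction on the length.\<close>

definition step_dist :: "('a, 'e) pre_digraph \<Rightarrow> 'a \<Rightarrow> 'a \<Rightarrow> nat" where
  "step_dist G x y = (LEAST n. (x, y) \<in> arcs_ends G ^^ n)"

lemma (in wf_digraph) awalk_imp_relpow: "awalk u p v \<Longrightarrow> (u, v) \<in> arcs_ends G ^^ length p"
proof (induction p arbitrary: u)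
  case (Cons e p)
  then have "(u, head G e) \<in> arcs_ends G" and w: "awalk (head G e) p v"
    unfolding awalk_Cons_iff arcs_ends_conv by blast+
  with Cons.IH[OF w] show ?case unfolding list.size(4) add_Suc_right add_0_right by (intro relpow_Suc_I2)
next
  case Nil then show ?case unfolding awalk_Nil_iff by simp
qed

lemma (in wf_digraph) relpow_imp_awalk:
  "(u, v) \<in> arcs_ends G ^^ n \<Longrightarrow> u \<in> verts G \<Longrightarrow> \<exists>p. awalk u p v \<and> length p = n"
proof (induction n arbitrary: u)
  case (Suc n)
  obtain w where w: "(u, w) \<in> arcs_ends G" "(w, v) \<in> arcs_ends G ^^ n"
    using relpow_Suc_D2[OF Suc.prems(1)] by blast
  obtain e where e: "e \<in> arcs G" "tail G e = u" "head G e = w" using w(1) by (rule reachableE)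
  obtain p where "awalk w p v" "length p = n" using Suc.IH[OF w(2)] head_in_verts[OF e(1)] e(3) by blast
  then have "awalk u (e # p) v" "length (e # p) = Suc n" using e by (simp_all add: awalk_Cons_iff)
  then show ?case by blast
next
  case 0 then have "awalk u [] v" by (simp add: awalk_Nil_iff)
  then show ?case by (intro exI[of _ "[]"]) simp
qed

lemma (in wf_digraph) graph_dist_eq_step_dist:
  assumes u: "u \<in> verts G" and walk: "(u, v) \<in> arcs_ends G ^^ n"
  shows "graph_dist G u v = ereal (real (step_dist G u v))"
proof -
  have cost: "awalk_cost (\<lambda>_. 1) p = real (length p)" for p :: "'b list"
    by (induction p) auto
  have "(u, v) \<in> arcs_ends G ^^ step_dist G u v" using walk unfolding step_dist_def by (rule LeastI)
  then obtain p where p: "awalk u p v" "length p = step_dist G u v"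
    using relpow_imp_awalk u by blast
  have "graph_dist G u v = (INF p\<in>{p. awalk u p v}. ereal (real (length p)))"
    by (simp add: graph_dist_def \<mu>_def cost)
  also have "\<dots> = ereal (real (step_dist G u v))"
  proof (rule antisym)
    show "(INF p\<in>{p. awalk u p v}. ereal (real (length p))) \<le> ereal (real (step_dist G u v))"
      using p by (intro INF_lower2[of p]) auto
    show "ereal (real (step_dist G u v)) \<le> (INF p\<in>{p. awalk u p v}. ereal (real (length p)))"
    proof (rule INF_greatest)
      fix p assume "p \<in> {p. awalk u p v}"
      then have "(u, v) \<in> arcs_ends G ^^ length p" using awalk_imp_relpow by blast
      then show "ereal (real (step_dist G u v)) \<le> ereal (real (length p))"
        unfolding step_dist_def by (simp add: Least_le)
    qed
  qed
  finally show ?thesis .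
qed

lemma distance_regular_metric_step_dist:
  assumes G: "Digraph.graph G" "Digraph_Component.connected G"
    and diam: "graph_diameter G = ereal (real D)"
    and num: "intersection_numbers G D bs cs"
  shows "distance_regular_metric (verts G) (\<lambda>x y. x \<rightarrow>\<^bsub>G\<^esub> y) (step_dist G) D
    (\<lambda>i. real_of_int (bs i)) (\<lambda>i. real_of_int (cs i))"
proof -
  interpret Digraph.graph G by (rule G(1))
  define R where "R = arcs_ends G"
  define d where "d = step_dist G"
  have R_sym: "(x, y) \<in> R \<Longrightarrow> (y, x) \<in> R" for x y
    using sym_arcs unfolding R_def symmetric_def sym_def by blast
  have R_verts: "(x, y) \<in> R \<Longrightarrow> x \<in> verts G \<and> y \<in> verts G" for x y
    using adj_in_verts unfolding R_def by blast
  have pow_sym: "(x, y) \<in> R ^^ n \<Longrightarrow> (y, x) \<in> R ^^ n" for x y n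
  proof (induction n arbitrary: x y)
    case (Suc n)
    then obtain z where "(x, z) \<in> R ^^ n" "(z, y) \<in> R" by auto
    then show ?case using Suc.IH[of x z] R_sym[of z y] relpow_Suc_I2[of y z R x n] by blast
  qed auto
  have walk: "\<exists>n. (x, y) \<in> R ^^ n" if "x \<in> verts G" "y \<in> verts G" for x y
  proof -
    \<comment> \<open>Connectedness refers to the symmetric closure, which has the same reachability
      as the symmetric graph \<open>G\<close>.\<close>
    have "x \<rightarrow>\<^sup>*\<^bsub>with_proj (mk_symmetric G)\<^esub> y"
      using G(2) that unfolding Digraph_Component.connected_def strongly_connected_def by simp
    then have "x \<rightarrow>\<^sup>*\<^bsub>G\<^esub> y" using reachable_mk_symmetric_eq sym_arcs by blast
    then show ?thesis using awalk_imp_relpow unfolding reachable_awalk R_def by blast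
  qed
  have dI: "(x, y) \<in> R ^^ d x y" if "x \<in> verts G" "y \<in> verts G" for x y
    using walk[OF that] unfolding d_def step_dist_def R_def by (rule LeastI_ex)
  have d_min: "d x y \<le> n" if "(x, y) \<in> R ^^ n" for x y n
    using that unfolding d_def step_dist_def R_def by (rule Least_le)
  have gd: "graph_dist G x y = ereal (real (d x y))" if "x \<in> verts G" "y \<in> verts G" for x y
    using walk[OF that] graph_dist_eq_step_dist[OF that(1)] unfolding R_def d_def by blast
  have d_step: "d x z \<le> Suc (d x y)" if "x \<in> verts G" "(y, z) \<in> R" for x y z
    by (rule d_min, rule relpow_Suc_I) (use dI that R_verts in blast)+
  have d_pred: "\<exists>z. (y, z) \<in> R \<and> d x z = i" if xy: "x \<in> verts G" "y \<in> verts G" "d x y = Suc i" for x y i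
  proof -
    have "(x, y) \<in> R ^^ Suc i" using dI[OF xy(1,2)] unfolding xy(3) .
    then obtain z where z: "(x, z) \<in> R ^^ i" "(z, y) \<in> R" by auto
    have "d x z \<le> i" "d x y \<le> Suc (d x z)" by (rule d_min[OF z(1)], rule d_step[OF xy(1) z(2)])
    then show ?thesis using R_sym[OF z(2)] xy(3) by (intro exI[of _ z]) simp
  qed
  have d_le: "d x y \<le> D" if xy: "x \<in> verts G" "y \<in> verts G" for x y
  proof -
    have "graph_dist G x y \<le> graph_diameter G"
      unfolding graph_diameter_def using xy by (intro SUP_upper2[of x] SUP_upper2[of y] order_refl)
    then show ?thesis using gd xy diam by simp
  qed
  have ne: "verts G \<noteq> {}" using G(2) by (auto simp: Digraph_Component.connected_def strongly_connected_def)
  \<comment> \<open>The supremum is attained because distances are integers: otherwise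
    \<open>D - 1\<close> would bound all of them.\<close>
  have attD: "\<exists>x\<in>verts G. \<exists>y\<in>verts G. d x y = D"
  proof (rule ccontr)
    assume "\<not> ?thesis"
    then have less: "d x y < D" if "x \<in> verts G" "y \<in> verts G" for x y
      using d_le[OF that] that le_neq_implies_less by blast
    have "graph_diameter G \<le> ereal (real D - 1)" unfolding graph_diameter_def
    proof (intro SUP_least)
      fix x y assume "x \<in> verts G" "y \<in> verts G"
      then show "graph_dist G x y \<le> ereal (real D - 1)" using less[of x y] gd[of x y] by simp
    qed
    then show False using diam by simp
  qed
  \<comment> \<open>Descending from \<open>D\<close>, a predecessor on a shortest walk realises each
    smaller distance.\<close>
  have att: "\<exists>x\<in>verts G. \<exists>y\<in>verts G. d x y = i" if "i \<le> D" for i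
    using that
  proof (induction rule: inc_induct)
    case base
    show ?case by (rule attD)
  next
    case (step n)
    then obtain x y where xy: "x \<in> verts G" "y \<in> verts G" "d x y = Suc n" by blast
    then obtain z where "(y, z) \<in> R" "d x z = n" using d_pred by blast
    then show ?case using R_verts xy(1) by blast
  qed
  have cards: "card {z. (y, z) \<in> R \<and> graph_dist G x z = ereal r}
      = card {z. (y, z) \<in> R \<and> real (d x z) = r}" if "x \<in> verts G" for x y r
    by (rule arg_cong[where f=card]) (use gd R_verts that in auto)
  have numE: "int (card {z. (y, z) \<in> R \<and> real (d x z) = real (d x y) - 1}) = cs (d x y)"
    "int (card {z. (y, z) \<in> R \<and> real (d x z) = real (d x y) + 1}) = bs (d x y)"
    if xy: "x \<in> verts G" "y \<in> verts G" for x y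
    using num[unfolded intersection_numbers_def R_def[symmetric], rule_format, OF d_le[OF xy] xy gd[OF xy]]
    unfolding cards[OF xy(1)] by blast+
  show ?thesis unfolding R_def[symmetric] d_def[symmetric]
  proof unfold_locales
    fix x y assume xy: "x \<in> verts G" "y \<in> verts G"
    show "d x y = d y x"
      by (rule antisym) (use dI[OF xy] dI[OF xy(2,1)] pow_sym d_min in blast)+
    show d0: "d x y = 0 \<longleftrightarrow> x = y"
      using dI[OF xy] d_min[of x y 0] by auto
    show "d x y = 1 \<longleftrightarrow> (x, y) \<in> R"
    proof
      show "d x y = 1 \<Longrightarrow> (x, y) \<in> R" using dI[OF xy] by auto
      assume a: "(x, y) \<in> R"
      then have "x \<noteq> y" using adj_not_same unfolding R_def by blast
      then show "d x y = 1" using d_min[of x y 1] a d0 by (simp add: le_Suc_eq)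
    qed
    have "real_of_int (cs (d x y)) = real (card {z. (y, z) \<in> R \<and> real (d x z) = real (d x y) - 1})"
      unfolding numE(1)[OF xy, symmetric] by simp
    also have "{z. (y, z) \<in> R \<and> real (d x z) = real (d x y) - 1} = {z. (y, z) \<in> R \<and> Suc (d x z) = d x y}"
      by auto
    finally show "real (card {z. (y, z) \<in> R \<and> Suc (d x z) = d x y}) = real_of_int (cs (d x y))" ..
    have "real_of_int (bs (d x y)) = real (card {z. (y, z) \<in> R \<and> real (d x z) = real (d x y) + 1})"
      unfolding numE(2)[OF xy, symmetric] by simp
    also have "{z. (y, z) \<in> R \<and> real (d x z) = real (d x y) + 1} = {z. (y, z) \<in> R \<and> d x z = Suc (d x y)}"
      by auto
    finally show "real (card {z. (y, z) \<in> R \<and> d x z = Suc (d x y)}) = real_of_int (bs (d x y))" ..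
    show "d x y \<le> D" by (rule d_le[OF xy])
    show "\<exists>z. (y, z) \<in> R \<and> d x z = i" if "d x y = Suc i" for i by (rule d_pred[OF xy that])
  qed (fact R_sym R_verts d_step att finite_verts)+
qed

section \<open>Classical parameters\<close>

lemma qnum_0: "qnum q 0 = 0" by (simp add: qnum_def)

lemma qnum_Suc: "qnum q (Suc i) = 1 + real_of_int q * qnum q i"
  unfolding qnum_def by (subst sum.lessThan_Suc_shift) (simp add: sum_distrib_left)

text \<open>Replacing powers by \<open>qnum\<close> turns the identities for intersection numbers
  into polynomial ones.\<close>

lemma power_eq_qnum: "real_of_int q ^ i = 1 + (real_of_int q - 1) * qnum q i"
proof (induction i)
  case (Suc i)
  have "real_of_int q ^ Suc i = real_of_int q * (1 + (real_of_int q - 1) * qnum q i)"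
    unfolding power_Suc Suc.IH ..
  then show ?case by (simp add: qnum_Suc algebra_simps)
qed (simp add: qnum_0)

lemma qnum_mono: "q \<ge> 0 \<Longrightarrow> i \<le> j \<Longrightarrow> qnum q i \<le> qnum q j"
  unfolding qnum_def by (rule sum_mono2) auto

text \<open>Here \<open>g\<close> stands for [D], \<open>g * \<beta>\<close> for the valency and
  \<open>\<beta> + \<alpha> * (g - 1)\<close> for \<open>a 1 + 1\<close>. The difference of the
  sides splits as (\<beta> - n) (n - p g) + n (\<alpha> - p) (g - 1), which is positive for n > p
  g.\<close>

lemma large_clique_upper_bound:
  fixes \<alpha> \<beta> p g n :: real
  assumes "\<alpha> > p" "g > 1" "n > 0" "n \<le> \<beta>"
    and "n * (\<beta> + \<alpha> * (g - 1) - n) \<le> p * (g * \<beta> - n)"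
  shows "n \<le> p * g"
proof (rule ccontr)
  assume "\<not> ?thesis"
  then have "0 \<le> (\<beta> - n) * (n - p * g)" using assms by simp
  moreover have "0 < n * ((\<alpha> - p) * (g - 1))" using assms by simp
  moreover have "n * (\<beta> + \<alpha> * (g - 1) - n) - p * (g * \<beta> - n)
      = (\<beta> - n) * (n - p * g) + n * ((\<alpha> - p) * (g - 1))" by (simp add: algebra_simps)
  ultimately show False using assms by linarith
qed

text \<open>
  The left side minus the right side is concave in \<open>n\<close>, so it is positive between \<open>S / (2 m)\<close> and
  \<open>\<beta>\<close> once it is positive at both ends; at the left end this is \<open>S\<^sup>2 \<ge> 4 \<alpha> \<beta> (g - 1)\<close>.
\<close>

lemma large_clique_upper_bound':
  fixes \<alpha> \<beta> q m p g n S :: real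
  assumes q: "q \<ge> 2" and m: "m = q + 1" and p: "p = q * m" and \<alpha>: "\<alpha> > q * p" and \<beta>: "\<beta> > 0"
    and g: "g \<ge> 2 * q\<^sup>2 + q" and n: "n \<le> \<beta>" and S: "S = \<beta> + \<alpha> * (g - 1)"
    and ineq: "n * (S - n) \<le> p * (g * \<beta> - n)"
  shows "n \<le> S / (2 * m)"
proof (rule ccontr)
  define N where "N = S / (2 * m)"
  assume "\<not> ?thesis"
  then have nN: "n > N" by (simp add: N_def)
  have pos: "m > 0" "p > 0" using q m p by auto
  have q2: "q\<^sup>2 \<ge> 2 * q" using q by (simp add: power2_eq_square)
  have g1: "g > 1" using g q q2 by linarith
  have "1 * p \<le> q * p" using q pos by (intro mult_right_mono) auto
  then have \<alpha>p: "\<alpha> > p" "\<alpha> > 0" using \<alpha> pos by linarith+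
  have "S > 0" unfolding S using \<alpha>p g1 \<beta> by (simp add: add_pos_pos)
  then have N: "N > 0" using pos by (simp add: N_def)
  \<comment> \<open>The difference of the sides is (\<beta> - n) (n - N) + \<open>l n\<close> with
    \<open>l\<close> affine, so positivity of \<open>l\<close> at \<open>N\<close> and at \<beta>
    suffices.\<close>
  define l where "l x = x * (S + p - \<beta> - N) - p * (g * \<beta>) + \<beta> * N" for x
  \<comment> \<open>The inequality \<open>A\<close> below expands to (q^2 - q - 1) g \<ge> 2 q^2 +
    q; the first factor is at least 1, whence the assumed bound on \<open>g\<close>.\<close>
  have "(q\<^sup>2 - q - 1) * g \<ge> 1 * (2 * q\<^sup>2 + q)" using g q2 q by (intro mult_mono) auto
  then have A: "(2 * m - 1) * (q * (g - 1)) \<ge> m\<^sup>2 * g"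
    unfolding m by (simp add: algebra_simps power2_eq_square)
  have "(\<beta> - \<alpha> * (g - 1))\<^sup>2 \<ge> 0" by simp
  then have "4 * (\<beta> * (\<alpha> * (g - 1))) \<le> S\<^sup>2" unfolding S by (simp add: algebra_simps power2_eq_square)
  moreover have "4 * (\<beta> * (q * p * (g - 1))) \<le> 4 * (\<beta> * (\<alpha> * (g - 1)))"
    using \<alpha> \<beta> g1 by (intro mult_left_mono mult_right_mono) auto
  ultimately have "(2 * m - 1) * (4 * (\<beta> * (q * p * (g - 1)))) \<le> (2 * m - 1) * S\<^sup>2"
    using q m by (intro mult_left_mono) auto
  moreover have "4 * \<beta> * p * (m\<^sup>2 * g) \<le> 4 * \<beta> * p * ((2 * m - 1) * (q * (g - 1)))"
    using A \<beta> pos by (intro mult_left_mono) auto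
  ultimately have "4 * m\<^sup>2 * (p * (g * \<beta>)) \<le> (2 * m - 1) * S\<^sup>2" by (simp add: algebra_simps)
  also have "\<dots> = 4 * m\<^sup>2 * (N * (S - N))"
    using pos unfolding N_def by (simp add: field_simps power2_eq_square)
  finally have "p * (g * \<beta>) \<le> N * (S - N)" using pos by simp
  moreover have "0 < N * p" using N pos by simp
  ultimately have lN: "l N > 0" unfolding l_def by (simp add: algebra_simps)
  have "l \<beta> = \<beta> * ((\<alpha> - p) * (g - 1))" unfolding l_def S by (simp add: algebra_simps)
  then have l\<beta>: "l \<beta> > 0" using \<beta> \<alpha>p g1 by simp
  have "(\<beta> - N) * l n = (\<beta> - n) * l N + (n - N) * l \<beta>" unfolding l_def by (simp add: algebra_simps)
  moreover have "\<dots> > 0" using lN l\<beta> nN n by (simp add: add_nonneg_pos)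
  ultimately have "0 < (\<beta> - N) * l n" by simp
  then have "l n > 0" by (rule zero_less_mult_pos) (use nN n in linarith)
  moreover have "0 \<le> (\<beta> - n) * (n - N)" using nN n by simp
  moreover have "n * (S - n) - p * (g * \<beta> - n) = (\<beta> - n) * (n - N) + l n"
    unfolding l_def by (simp add: algebra_simps)
  ultimately show False using ineq by linarith
qed

locale classical_parameters_metric = distance_regular_metric V adj d D b c
  for V :: "'a set" and adj d D b c +
  fixes q :: int and \<alpha> \<beta> :: real
  assumes D_ge: "D \<ge> 3" and q_ge: "q \<ge> 2"
    and c_eq: "i \<le> D \<Longrightarrow> c i = qnum q i * (1 + \<alpha> * qnum q (i - 1))"
    and b_eq: "i \<le> D \<Longrightarrow> b i = (qnum q D - qnum q i) * (\<beta> - \<alpha> * qnum q i)"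
begin

abbreviation Q :: real where "Q \<equiv> real_of_int q"

lemma Q_ge: "Q \<ge> 2" using q_ge by simp

lemma qnum_nonneg: "qnum q i \<ge> 0" using qnum_mono[of q 0 i] q_ge by (simp add: qnum_0)

lemma qnum_small: "qnum q (Suc 0) = 1" "qnum q 2 = Q + 1" "qnum q 3 = Q\<^sup>2 + Q + 1"
  by (simp_all add: numeral_2_eq_2 numeral_3_eq_3 qnum_Suc qnum_0 algebra_simps)

lemma qnum_D_ge: "qnum q D \<ge> Q\<^sup>2 + Q + 1" using qnum_mono[OF _ D_ge, of q] q_ge by (simp add: qnum_small)

section \<open>Constraints on the parameters\<close>

text \<open>\<open>M\<close> is the number of common neighbours of two vertices at distance 2, less
  one. It yields the integrality of (q + 1) \<alpha> and later bounds common neighbours in local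
  graphs.\<close>

lemma \<alpha>_eq: obtains M :: nat where "c 2 = real M + 1" and "real M = (Q + 1) * \<alpha> + Q"
proof -
  obtain x y where xy: "x \<in> V" "y \<in> V" "d x y = 2" using d_attained[of 2] D_ge by auto
  define n where "n = card {z. adj y z \<and> Suc (d x z) = d x y}"
  have n: "c 2 = real n" using c_card[OF xy(1,2)] xy(3) by (simp add: n_def)
  have "c 2 > 0" using c_pos[of 2] D_ge by simp
  then have "n > 0" using n by simp
  then have 1: "c 2 = real (n - 1) + 1" using n by (simp add: of_nat_diff)
  have "c 2 = (Q + 1) * (1 + \<alpha>)" using c_eq[of 2] D_ge by (simp add: qnum_small)
  then have "real (n - 1) = (Q + 1) * \<alpha> + Q" using 1 by (simp add: algebra_simps)
  then show ?thesis using that 1 by blast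
qed

text \<open>Integrality comes from \<open>c 2\<close>, and \<open>c 3\<close> > 0 forces (q + 1)
  \<alpha> > -1; an integer above -1 is non-negative.\<close>

lemma \<alpha>_nat: "(Q + 1) * \<alpha> \<in> \<nat>" and \<alpha>_nonneg: "\<alpha> \<ge> 0"
proof -
  obtain M :: nat where M: "real M = (Q + 1) * \<alpha> + Q" using \<alpha>_eq by blast
  have "c 3 = (Q\<^sup>2 + Q + 1) * (1 + \<alpha> * (Q + 1))" using c_eq[of 3] D_ge by (simp add: qnum_small)
  moreover have "c 3 > 0" using c_pos[of 3] D_ge by simp
  moreover have "Q\<^sup>2 + Q + 1 > 0" using Q_ge by (simp add: add_nonneg_pos)
  ultimately have gt: "1 + \<alpha> * (Q + 1) > 0" by (simp add: zero_less_mult_iff)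
  define z where "z = int M - q"
  have z: "(Q + 1) * \<alpha> = real_of_int z" using M by (simp add: z_def)
  then have "real_of_int z > -1" using gt by (simp add: mult.commute)
  then have "z \<ge> 0" by linarith
  then show nat: "(Q + 1) * \<alpha> \<in> \<nat>" unfolding z by (metis Nats_altdef2 Ints_of_int mem_Collect_eq of_int_0_le_iff)
  show "\<alpha> \<ge> 0" using z \<open>z \<ge> 0\<close> Q_ge by (metis add_nonneg_pos of_int_0_le_iff order_trans zero_le_mult_iff zero_le_numeral zero_less_one linorder_not_less)
qed

lemma b_0: "b 0 = qnum q D * \<beta>" using b_eq[of 0] by (simp add: qnum_0)

text \<open>This is \<open>a D\<close> \<ge> 0 divided by [D].\<close>

lemma \<beta>_ge: "\<beta> \<ge> 1 + \<alpha> * qnum q (D - 1)"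
proof -
  have "qnum q D * (\<beta> - (1 + \<alpha> * qnum q (D - 1))) = a D"
    using c_eq[of D] b_eq[of D] by (simp add: a_def b_0 algebra_simps)
  then have "0 \<le> qnum q D * (\<beta> - (1 + \<alpha> * qnum q (D - 1)))" using a_nonneg[of D] by simp
  moreover have "qnum q D > 0" using qnum_D_ge Q_ge by (smt (verit) zero_le_power2)
  ultimately show ?thesis by (simp add: zero_le_mult_iff)
qed

lemma \<beta>_pos: "\<beta> > 0" using \<beta>_ge \<alpha>_nonneg qnum_nonneg[of "D - 1"] by (smt (verit) mult_nonneg_nonneg)

lemma qnum_D_gt_1: "qnum q D > 1" using qnum_D_ge Q_ge by (smt (verit) zero_le_power2)

lemma a_1: "a 1 = \<beta> - 1 + \<alpha> * (qnum q D - 1)"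
  using c_eq[of 1] b_eq[of 1] D_ge b_0 unfolding a_def by (simp add: qnum_small qnum_0 algebra_simps)

section \<open>Cosine sequences of two eigenvalues\<close>

text \<open>This is 1 - \<theta> / \<open>b 0\<close> for the eigenvalue \<theta> =
  \<open>b 1\<close> / q - 1.\<close>

definition \<eta> :: real where
  "\<eta> = ((Q - 1) * b 0 + Q + \<beta> + \<alpha> * (qnum q D - 1)) / (b 0 * Q)"

lemma b_0_pos: "b 0 > 0" using b_0 \<beta>_pos qnum_D_gt_1 by simp

lemma \<eta>_eq: "b 0 * \<eta> * Q = (Q - 1) * b 0 + Q + \<beta> + \<alpha> * (qnum q D - 1)"
  using b_0_pos Q_ge by (simp add: \<eta>_def)

text \<open>The cosine sequence of the second largest eigenvalue.\<close>

definition cosine_1 :: "nat \<Rightarrow> real" where "cosine_1 i = 1 - \<eta> * qnum q i * Q / Q ^ i"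

text \<open>Consecutive differences of the sequence are geometric, so the recurrence reduces to q
  \<open>c i\<close> - \<open>b i\<close> = [i] \<open>b 0\<close> \<eta> q - \<open>b 0\<close>
  q^i, the fact \<open>key\<close> of the proof.\<close>

lemma cosine_1_recurrence:
  assumes "i \<le> D"
  shows "c i * cosine_1 (i - 1) + a i * cosine_1 i + b i * cosine_1 (Suc i) = b 0 * (1 - \<eta>) * cosine_1 i"
proof (cases i)
  case 0
  then show ?thesis using c_eq[of 0] Q_ge
    by (simp add: a_def cosine_1_def qnum_0 qnum_Suc)
next
  case (Suc j)
  define g where "g = qnum q j"
  define P where "P = Q ^ j"
  have P: "P = 1 + (Q - 1) * g" unfolding P_def g_def by (rule power_eq_qnum)
  have PQ: "P > 0" "Q > 0" using Q_ge by (auto simp: P_def)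
  have u: "cosine_1 (i - 1) = 1 - \<eta> * g * Q / P" "cosine_1 i = 1 - \<eta> * (1 + Q * g) / P"
    "cosine_1 (Suc i) = 1 - \<eta> * (1 + Q * (1 + Q * g)) / (Q * P)"
    using Suc PQ by (simp_all add: cosine_1_def qnum_Suc g_def P_def)
  have c: "c i = (1 + Q * g) * (1 + \<alpha> * g)" using c_eq[OF assms] Suc by (simp add: qnum_Suc g_def)
  have b: "b i = (qnum q D - (1 + Q * g)) * (\<beta> - \<alpha> * (1 + Q * g))"
    using b_eq[OF assms] Suc by (simp add: qnum_Suc g_def)
  have key: "Q * c i - b i = (1 + Q * g) * (b 0 * \<eta> * Q) - b 0 * (Q * P)"
    unfolding \<eta>_eq unfolding c b b_0 P by (simp add: algebra_simps)
  have d1: "cosine_1 (i - 1) - cosine_1 i = \<eta> / P" unfolding u using PQ by (simp add: field_simps)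
  have d2: "cosine_1 (Suc i) - cosine_1 i = - \<eta> / (Q * P)" unfolding u using PQ by (simp add: field_simps)
  have "c i * cosine_1 (i - 1) + a i * cosine_1 i + b i * cosine_1 (Suc i)
      = b 0 * cosine_1 i + c i * (cosine_1 (i - 1) - cosine_1 i) + b i * (cosine_1 (Suc i) - cosine_1 i)"
    by (simp add: a_def algebra_simps)
  also have "\<dots> = b 0 * cosine_1 i + \<eta> * (Q * c i - b i) / (Q * P)"
    unfolding d1 d2 using PQ by (simp add: field_simps)
  also have "\<eta> * (Q * c i - b i) / (Q * P) = - b 0 * \<eta> * cosine_1 i"
    unfolding key u using PQ by (simp add: field_simps)
  finally show ?thesis by (simp add: algebra_simps)
qed

text \<open>The cosine sequence of the smallest eigenvalue.\<close>

primrec cosine_D :: "nat \<Rightarrow> real" where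
  "cosine_D 0 = 1"
| "cosine_D (Suc i) = - cosine_D i * (1 + \<alpha> * qnum q i) / (\<beta> - \<alpha> * qnum q i)"

text \<open>Both outer terms become multiples of \<open>cosine_D i\<close>, and together with
  \<open>a i\<close> they add up to -[D]. A division by zero in the definition can first affect
  \<open>cosine_D (Suc D)\<close>, whose coefficient \<open>b D\<close> is zero.\<close>

lemma cosine_D_recurrence:
  assumes "i \<le> D"
  shows "c i * cosine_D (i - 1) + a i * cosine_D i + b i * cosine_D (Suc i) = - qnum q D * cosine_D i"
proof -
  have nz: "\<beta> - \<alpha> * qnum q j \<noteq> 0" if "j < D" for j
  proof -
    have "qnum q j \<le> qnum q (D - 1)" using that q_ge by (intro qnum_mono) auto
    then have "\<alpha> * qnum q j \<le> \<alpha> * qnum q (D - 1)" using \<alpha>_nonneg by (rule mult_left_mono)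
    then show ?thesis using \<beta>_ge by linarith
  qed
  have B: "b i * cosine_D (Suc i) = - (qnum q D - qnum q i) * (1 + \<alpha> * qnum q i) * cosine_D i"
  proof (cases "i = D")
    case False
    then have "i < D" using assms by simp
    from nz[OF this] show ?thesis using b_eq[OF assms] by simp (simp add: algebra_simps)
  qed (use b_eq[of D] in simp)
  show ?thesis
  proof (cases i)
    case 0
    then show ?thesis using B c_eq[of 0] by (simp add: a_def qnum_0)
  next
    case (Suc j)
    have j: "\<beta> - \<alpha> * qnum q j \<noteq> 0" by (rule nz) (use Suc assms in simp)
    have "1 + \<alpha> * qnum q j > 0" using \<alpha>_nonneg qnum_nonneg[of j] by (simp add: add_pos_nonneg)
    then have C: "c i * cosine_D (i - 1) = - qnum q i * (\<beta> - \<alpha> * qnum q j) * cosine_D i"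
      using c_eq[OF assms] Suc j by (simp add: field_simps)
    have "i - 1 = j" using Suc by simp
    then show ?thesis unfolding B C
      by (simp add: a_def b_0 c_eq[OF assms] b_eq[OF assms] algebra_simps)
  qed
qed

section \<open>Cliques and local graphs\<close>

text \<open>The sequence of the smallest eigenvalue has \<open>cosine_D 1\<close> = -1/\<beta>.
  Adjoining \<open>x\<close> to the clique in \<open>clique_form\<close> gives 0 \<le> 1 - |C| /
  \<beta>.\<close>

lemma clique_card_le:
  assumes x: "x \<in> V" and C: "C \<subseteq> {y. adj x y}" "\<And>y z. y \<in> C \<Longrightarrow> z \<in> C \<Longrightarrow> y \<noteq> z \<Longrightarrow> adj y z"
  shows "real (card C) \<le> \<beta>"
proof -
  have CV: "C \<subseteq> V" using C adj_V by auto
  have "\<not> adj x x" using d_eq_0[OF x x] d_eq_1[OF x x] by auto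
  then have xC: "x \<notin> C" using C by auto
  have fC: "finite C" using CV finite_V finite_subset by blast
  have "0 \<le> 1 + (real (card (insert x C)) - 1) * cosine_D 1"
  proof (rule clique_form[OF _ cosine_D_recurrence])
    show "insert x C \<subseteq> V" using x CV by simp
    show "adj y z" if "y \<in> insert x C" "z \<in> insert x C" "y \<noteq> z" for y z
      using that C adj_sym by blast
  qed auto
  also have "\<dots> = 1 - real (card C) / \<beta>" using xC fC by (simp add: qnum_0)
  finally show ?thesis using \<beta>_pos by (simp add: field_simps)
qed

text \<open>The value q + 1 is the ratio of 1 - u 2 = \<eta> (q + 1) / q to u 1 - u 2 = \<eta> / q
  for the sequence u = \<open>cosine_1\<close>.\<close>

lemma local_graph:
  assumes x: "x \<in> V" and M: "c 2 = real M + 1"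
  shows "graph_least_eigenvalue {y. adj x y} adj (nat (q + 1)) M"
proof unfold_locales
  have irr: "\<not> adj y y" for y using d_eq_0[of y y] d_eq_1[of y y] adj_V[of y y] by auto
  show "finite {y. adj x y}" using finite_nbrs[of x "\<lambda>_. True"] by simp
  show "adj v u" if "adj u v" for u v by (rule adj_sym[OF that])
  show "\<not> adj v v" for v by (rule irr)
  show "0 < nat (q + 1)" using q_ge by simp
  have u0: "cosine_1 0 = 1" and u1: "cosine_1 1 = 1 - \<eta>" and u2: "cosine_1 2 = 1 - \<eta> * (Q + 1) / Q"
    using Q_ge qnum_small by (simp_all add: cosine_1_def qnum_0 power2_eq_square)
  \<comment> \<open>For \<eta> > 0, the estimate q - 1 \<le> \<eta> q is equivalent to u 2 \<le> (u
    1)^2.\<close>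
  have "(Q - 1) * b 0 \<le> b 0 * \<eta> * Q"
    unfolding \<eta>_eq using Q_ge \<beta>_pos \<alpha>_nonneg qnum_D_gt_1 by simp
  then have \<eta>: "Q - 1 \<le> \<eta> * Q" using b_0_pos by (simp add: mult.assoc mult.commute[of "Q - 1"])
  then have "\<eta> * Q > 0" using Q_ge by linarith
  then have \<eta>_pos: "\<eta> > 0" using Q_ge by (simp add: zero_less_mult_iff)
  show "0 \<le> (\<Sum>y\<in>{y. adj x y}. \<Sum>z\<in>{y. adj x y}. if adj y z then w y * w z else 0)
      + real (nat (q + 1)) * (\<Sum>y\<in>{y. adj x y}. (w y)\<^sup>2)" for w
  proof (rule local_graph_least_eigenvalue[OF u0 cosine_1_recurrence _ _ _ x])
    show "cosine_1 2 < cosine_1 1" using Q_ge \<eta>_pos unfolding u1 u2 by (simp add: field_simps)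
    have "\<eta> * (Q - 1) \<le> \<eta> * (\<eta> * Q)" using \<eta> \<eta>_pos by (intro mult_left_mono) auto
    then show "cosine_1 2 \<le> (cosine_1 1)\<^sup>2"
      using Q_ge unfolding u1 u2 by (simp add: field_simps power2_eq_square)
    show "1 - cosine_1 2 = real (nat (q + 1)) * (cosine_1 1 - cosine_1 2)"
      using Q_ge q_ge unfolding u1 u2 by (simp add: field_simps)
  qed
  fix u v assume uv: "u \<in> {y. adj x y}" "v \<in> {y. adj x y}" "u \<noteq> v" "\<not> adj u v"
  have V: "u \<in> V" "v \<in> V" using uv adj_V by auto
  have "d u v \<le> Suc (d u x)" using d_step[of u x v] uv V by simp
  moreover have "d u x = 1" using d_eq_1[of u x] V x uv adj_sym by simp
  moreover have "d u v \<noteq> 0" "d u v \<noteq> 1" using d_eq_0[OF V] d_eq_1[OF V] uv by auto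
  ultimately have d2: "d u v = 2" by linarith
  let ?Z = "{z \<in> {y. adj x y}. adj u z \<and> adj v z}"
  \<comment> \<open>Besides the vertices of \<open>?Z\<close>, also \<open>x\<close> is a common
    neighbour of \<open>u\<close> and \<open>v\<close>; this accounts for \<open>M\<close> =
    \<open>c 2\<close> - 1.\<close>
  have sub: "insert x ?Z \<subseteq> {z. adj v z \<and> Suc (d u z) = d u v}"
  proof
    fix z assume "z \<in> insert x ?Z"
    then have z: "adj u z" "adj v z" using uv adj_sym by auto
    then have "d u z = 1" using d_eq_1[of u z] adj_V by blast
    then show "z \<in> {z. adj v z \<and> Suc (d u z) = d u v}" using z d2 by simp
  qed
  have fZ: "finite ?Z" by (rule finite_subset[OF _ finite_nbrs[of v "\<lambda>_. True"]]) auto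
  have "card (insert x ?Z) \<le> card {z. adj v z \<and> Suc (d u z) = d u v}"
    by (rule card_mono[OF finite_nbrs sub])
  then have "card ?Z + 1 \<le> card {z. adj v z \<and> Suc (d u z) = d u v}" using fZ irr by simp
  also have "\<dots> = M + 1" using c_card[OF V] M unfolding d2 by (metis of_nat_1 of_nat_add of_nat_eq_iff)
  finally show "card ?Z \<le> M" by simp
qed

text \<open>\<open>N\<close> is any upper bound for clique sizes that follows from the edge count;
  the bounds on \<beta> and on \<alpha> use different choices of it.\<close>

lemma a_1_le:
  fixes N m p :: real
  assumes \<alpha>: "\<alpha> > Q * (Q + 1)" and N: "N \<ge> 0"
    and clique: "\<And>n. \<lbrakk>0 < n; n \<le> \<beta>; n * (a 1 + 1 - n) \<le> p * (qnum q D * \<beta> - n)\<rbrakk> \<Longrightarrow> n \<le> N"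
    and m: "m = Q + 1" and p: "p = Q * m"
  shows "a 1 \<le> m * N + m\<^sup>2 * (m * \<alpha> + Q + p * (p + 1) + 1) + m\<^sup>2 * (m\<^sup>2 - 1) / 2 * (m * \<alpha> + Q)"
proof -
  obtain M where M: "c 2 = real M + 1" "real M = m * \<alpha> + Q" using \<alpha>_eq m by metis
  obtain x y where xy: "x \<in> V" "y \<in> V" "d x y = 1" using d_attained[of 1] D_ge by auto
  define X where "X = {y. adj x y}"
  define k where "k = nat (q + 1)"
  interpret L: graph_least_eigenvalue X adj k M unfolding X_def k_def by (rule local_graph[OF xy(1) M(1)])
  have k: "real k = m" using q_ge by (simp add: k_def m)
  have "k > 0" using q_ge by (simp add: k_def)
  then have Lp: "real L.p = p" using k by (simp add: L.p_def of_nat_diff p m)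
  have reg: "real (card {v \<in> X. adj z v}) = a 1" if "z \<in> X" for z
  proof -
    have z: "z \<in> V" "d x z = 1" using that adj_V d_eq_1[of x z] by (auto simp: X_def)
    have "{v \<in> X. adj z v} = {v. adj z v \<and> d x v = d x z}"
    proof -
      have "adj x v \<longleftrightarrow> d x v = d x z" if "adj z v" for v
        using d_eq_1[OF xy(1), of v] adj_V[OF that] z by simp
      then show ?thesis by (auto simp: X_def)
    qed
    then show ?thesis using a_card[OF xy(1) z(1)] z(2) by simp
  qed
  have cX: "real (card X) = qnum q D * \<beta>" using valency[OF xy(1)] b_0 by (simp add: X_def)
  have yX: "y \<in> X" using xy d_eq_1[OF xy(1,2)] by (simp add: X_def)
  have M_ge: "k * (L.p + 1) \<le> M"
  proof -
    \<comment> \<open>This gives \<open>M + 1\<close> > m (p + 1) only; the required bound on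
      \<open>M\<close> follows because both sides are integers.\<close>
    have "m * (Q * m) < m * \<alpha>" using \<alpha> Q_ge unfolding m by (intro mult_strict_left_mono) auto
    then have "real (k * (L.p + 1)) < real (M + 1)" using M(2) by (simp add: k Lp p m algebra_simps)
    then show ?thesis by (simp only: of_nat_less_iff)
  qed
  have "real (card {v \<in> X. adj y v})
      \<le> k * N + real (k\<^sup>2 * (M + L.p * (L.p + 1) + 1) + (k\<^sup>2 choose 2) * M)"
  proof (rule L.valency_le[OF yX M_ge N])
    fix C assume C: "L.maximal_clique C" "y \<in> C" "M + L.p * (L.p + 1) + 1 < card C"
    have cl: "C \<subseteq> {y. adj x y}" "\<And>u v. u \<in> C \<Longrightarrow> v \<in> C \<Longrightarrow> u \<noteq> v \<Longrightarrow> adj u v"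
      using C(1) unfolding L.maximal_clique_def L.clique_def by (auto simp: X_def)
    have n: "real (card C) \<le> \<beta>" by (rule clique_card_le[OF xy(1) cl])
    have "card {v \<in> X. adj z v} = card {v \<in> X. adj y v}" if "z \<in> C" for z
      using reg[of z] reg[OF yX] that cl(1) by (simp add: X_def subset_iff)
    then have "real (card C) * (real (card {v \<in> X. adj y v}) + 1 - real (card C))
        \<le> real L.p * (real (card X) - real (card C))"
      using L.maximal_clique_edge_count[OF C(1)] C(3) by simp
    then have "real (card C) * (a 1 + 1 - real (card C)) \<le> p * (qnum q D * \<beta> - real (card C))"
      unfolding reg[OF yX] cX Lp .
    then show "real (card C) \<le> N" using clique[of "real (card C)"] n C(3) by simp
  qed
  moreover have "real (k\<^sup>2 choose 2) = m\<^sup>2 * (m\<^sup>2 - 1) / 2"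
  proof -
    have "k\<^sup>2 \<ge> 1" using \<open>k > 0\<close> by simp
    moreover have "even (k\<^sup>2 * (k\<^sup>2 - 1))" by (cases "even k") auto
    ultimately show ?thesis
      by (simp add: choose_two real_of_nat_div of_nat_diff k)
  qed
  ultimately show ?thesis unfolding reg[OF yX] by (simp add: k Lp M(2) algebra_simps)
qed

section \<open>The bounds on \<beta> and \<alpha>\<close>

text \<open>Take N = p [D] in \<open>a_1_le\<close>; then m N supplies the coefficient q (q + 1)^2
  of [D], and the term -\<alpha> [D] comes from \<open>a 1\<close>.\<close>

lemma \<beta>_less:
  assumes \<alpha>: "\<alpha> > Q * (Q + 1)"
  shows "\<beta> < (Q * (Q + 1)\<^sup>2 - \<alpha>) * qnum q D + (Q + 1) ^ 6 * Q
    + ((Q + 1) ^ 3 * ((Q + 1)\<^sup>2 + 1) / 2 + 1) * \<alpha> - Q"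
proof -
  define m where "m = Q + 1"
  define p where "p = Q * m"
  define g where "g = qnum q D"
  have "a 1 \<le> m * (p * g) + m\<^sup>2 * (m * \<alpha> + Q + p * (p + 1) + 1) + m\<^sup>2 * (m\<^sup>2 - 1) / 2 * (m * \<alpha> + Q)"
  proof (rule a_1_le[OF \<alpha> _ _ m_def p_def])
    show "0 \<le> p * g" using Q_ge qnum_nonneg by (simp add: p_def m_def g_def)
    show "n \<le> p * g" if "0 < n" "n \<le> \<beta>" "n * (a 1 + 1 - n) \<le> p * (qnum q D * \<beta> - n)" for n
    proof (rule large_clique_upper_bound)
      show "p < \<alpha>" using \<alpha> by (simp add: p_def m_def)
      show "n * (\<beta> + \<alpha> * (g - 1) - n) \<le> p * (g * \<beta> - n)" using that(3) unfolding a_1 g_def by simp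
    qed (use that qnum_D_gt_1 in \<open>simp_all add: g_def\<close>)
  qed
  \<comment> \<open>The left side collects the terms free of \<alpha> and [D], together with the q
    subtracted in the claim.\<close>
  moreover have "1 + m\<^sup>2 * (m\<^sup>2 + 1) / 2 * Q + m\<^sup>2 * (p\<^sup>2 + p + 1) + Q < m ^ 6 * Q"
  proof -
    obtain t where t: "Q = 2 + t" "t \<ge> 0" using Q_ge by (metis add.commute diff_add_cancel diff_ge_0_iff_ge)
    show ?thesis unfolding p_def m_def t(1) using t(2)
      by (simp add: algebra_simps power2_eq_square eval_nat_numeral add_nonneg_pos add_pos_nonneg)
  qed
  ultimately show ?thesis unfolding a_1 m_def[symmetric] g_def[symmetric]
    by (simp add: p_def field_simps power2_eq_square eval_nat_numeral)
qed

text \<open>For larger \<alpha>, cliques have at most S / (2 m) elements, where S =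
  \<open>a 1 + 1\<close>. So the \<open>m\<close> large ones cover at most half of S, and the other
  half is bounded by terms independent of [D]. This contradicts S \<ge> 1 + (q + 1) \<alpha>
  [D - 1].\<close>

lemma \<alpha>_le:
  assumes D: "D \<ge> 9"
  shows "\<alpha> \<le> Q\<^sup>2 * (Q + 1)"
proof (rule ccontr)
  define m where "m = Q + 1"
  define p where "p = Q * m"
  define g where "g = qnum q D"
  define h where "h = qnum q (D - 1)"
  define S where "S = \<beta> + \<alpha> * (g - 1)"
  define A where "A = m * \<alpha>"
  assume "\<not> ?thesis"
  then have \<alpha>: "\<alpha> > Q * p" by (simp add: p_def m_def power2_eq_square algebra_simps)
  obtain t where t: "Q = 2 + t" "t \<ge> 0" using Q_ge by (metis add.commute diff_add_cancel diff_ge_0_iff_ge)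
  have pos: "m > 0" "p > 0" using Q_ge by (auto simp: p_def m_def)
  have "1 * p \<le> Q * p" using Q_ge pos by (intro mult_right_mono) auto
  then have \<alpha>p: "\<alpha> > Q * (Q + 1)" using \<alpha> by (simp add: p_def m_def)
  have g: "g = 1 + Q * h" using qnum_Suc[of q "D - 1"] D by (simp add: g_def h_def)
  have "qnum q 8 \<le> h" unfolding h_def using q_ge D by (intro qnum_mono) auto
  \<comment> \<open>This is where \<open>D \<ge> 9\<close> enters: for q = 2 the sides are 180 and
    255, whereas [7] is only 127.\<close>
  moreover have "2 * (m ^ 4 + m\<^sup>2) \<le> qnum q 8"
    unfolding m_def t(1) using t
    by (simp add: eval_nat_numeral qnum_Suc qnum_0 algebra_simps)
  ultimately have h: "2 * (m ^ 4 + m\<^sup>2) \<le> h" by linarith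
  moreover have "2 * Q\<^sup>2 + Q \<le> 2 * (m ^ 4 + m\<^sup>2)" unfolding m_def t(1) using t
    by (simp add: eval_nat_numeral algebra_simps)
  moreover have "1 * h \<le> Q * h" using Q_ge qnum_nonneg by (intro mult_right_mono) (auto simp: h_def)
  ultimately have g_ge: "g \<ge> 2 * Q\<^sup>2 + Q" unfolding g by linarith
  have h0: "h \<ge> 0" using qnum_nonneg by (simp add: h_def)
  have S_eq: "a 1 + 1 = S" unfolding a_1 by (simp add: S_def g_def)
  have S: "S \<ge> 1 + A * h"
    using \<beta>_ge unfolding S_def g h_def[symmetric] A_def m_def by (simp add: algebra_simps)
  have A: "A \<ge> Q\<^sup>2 * m\<^sup>2"
    using \<alpha> pos mult_left_mono[of "Q * p" \<alpha> m] by (simp add: A_def p_def algebra_simps power2_eq_square)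
  have A0: "A \<ge> 0" using A by (meson order_trans zero_le_mult_iff zero_le_power2)
  have "a 1 \<le> m * (S / (2 * m)) + m\<^sup>2 * (m * \<alpha> + Q + p * (p + 1) + 1) + m\<^sup>2 * (m\<^sup>2 - 1) / 2 * (m * \<alpha> + Q)"
  proof (rule a_1_le[OF \<alpha>p _ _ m_def p_def])
    show "0 \<le> S / (2 * m)" using S A0 h0 pos by (simp add: add_nonneg_nonneg order_trans[of 0 "1 + A * h" S])
    show "n \<le> S / (2 * m)" if "0 < n" "n \<le> \<beta>" "n * (a 1 + 1 - n) \<le> p * (qnum q D * \<beta> - n)" for n
      using large_clique_upper_bound'[OF Q_ge m_def p_def \<alpha> \<beta>_pos g_ge that(2) S_def] that(3)
      unfolding S_eq g_def[symmetric] by blast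
  qed
  also have "\<dots> = S / 2 + m\<^sup>2 * (p * (p + 1) + 1) + (m ^ 4 + m\<^sup>2) / 2 * (A + Q)"
    using pos by (simp add: A_def field_simps eval_nat_numeral)
  finally have "A * h \<le> 1 + 2 * m\<^sup>2 * (p * (p + 1) + 1) + (m ^ 4 + m\<^sup>2) * (A + Q)"
    using S S_eq by (simp add: field_simps)
  \<comment> \<open>Half of this product absorbs the A-term on the right of the preceding estimate;
    by \<open>A\<close> \<ge> q^2 m^2 the other half exceeds what remains.\<close>
  moreover have "A * (2 * (m ^ 4 + m\<^sup>2)) \<le> A * h" using h A0 by (rule mult_left_mono)
  moreover have "(m ^ 4 + m\<^sup>2) * (Q\<^sup>2 * m\<^sup>2) \<le> (m ^ 4 + m\<^sup>2) * A" using A by (intro mult_left_mono) auto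
  moreover have "1 + 2 * m\<^sup>2 * (p * (p + 1) + 1) + (m ^ 4 + m\<^sup>2) * Q < (m ^ 4 + m\<^sup>2) * (Q\<^sup>2 * m\<^sup>2)"
    unfolding p_def m_def t(1) using t(2)
    by (simp add: eval_nat_numeral algebra_simps add_nonneg_pos add_pos_nonneg)
  ultimately show False by (simp add: algebra_simps)
qed

end

theorem theorem5p2:
  fixes G :: "('a, 'e) pre_digraph" and D :: nat and b :: int and \<alpha> \<beta> :: real
  assumes "D > 0" and "b > 0"
    and "distance_regular G"
    and "has_classical_parameters G D b \<alpha> \<beta>"
    and "D \<ge> 9" and "b \<ge> 2"
  shows "(real_of_int b + 1) * \<alpha> \<in> \<nat> \<and>
    (\<alpha> \<le> b * (b + 1) \<or>
     (b * (b + 1) < \<alpha> \<and> \<alpha> < b\<^sup>2 * (b + 1) + 1 \<and>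
      \<beta> < (b * (b + 1)\<^sup>2 - \<alpha>) * qnum b D + (b + 1) ^ 6 * b
          + ((real_of_int b + 1) ^ 3 * ((real_of_int b + 1)\<^sup>2 + 1) / 2 + 1) * \<alpha> - b)) \<and>
    (D \<ge> 10 \<longrightarrow> \<alpha> \<le> b\<^sup>2 * (b + 1))"
proof -
  obtain bs cs where num: "intersection_numbers G D bs cs"
    and cs: "\<And>i. i \<le> D \<Longrightarrow> real_of_int (cs i) = qnum b i * (1 + \<alpha> * qnum b (i - 1))"
    and bs: "\<And>i. i \<le> D \<Longrightarrow> real_of_int (bs i) = (qnum b D - qnum b i) * (\<beta> - \<alpha> * qnum b i)"
    using assms(4) unfolding has_classical_parameters_def by blast
  have G: "Digraph.graph G" "Digraph_Component.connected G"
    using assms(3) by (simp_all add: distance_regular_def)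
  have diam: "graph_diameter G = ereal (real D)"
    using assms(4) by (simp add: has_classical_parameters_def)
  interpret distance_regular_metric "verts G" "\<lambda>x y. x \<rightarrow>\<^bsub>G\<^esub> y" "step_dist G" D
    "\<lambda>i. real_of_int (bs i)" "\<lambda>i. real_of_int (cs i)"
    by (rule distance_regular_metric_step_dist[OF G diam num])
  interpret classical_parameters_metric "verts G" "\<lambda>x y. x \<rightarrow>\<^bsub>G\<^esub> y" "step_dist G" D
    "\<lambda>i. real_of_int (bs i)" "\<lambda>i. real_of_int (cs i)" b \<alpha> \<beta>
    by unfold_locales (use assms cs bs in auto)
  \<comment> \<open>This bound serves both the strict inequality for \<alpha> in the second
    alternative and the final claim.\<close>
  have \<alpha>: "\<alpha> \<le> (real_of_int b)\<^sup>2 * (real_of_int b + 1)" by (rule \<alpha>_le) fact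
  show ?thesis
  proof (intro conjI impI)
    show "(real_of_int b + 1) * \<alpha> \<in> \<nat>" by (rule \<alpha>_nat)
    show "\<alpha> \<le> b\<^sup>2 * (b + 1)" using \<alpha> by simp
    show "\<alpha> \<le> b * (b + 1) \<or> (b * (b + 1) < \<alpha> \<and> \<alpha> < b\<^sup>2 * (b + 1) + 1 \<and>
      \<beta> < (b * (b + 1)\<^sup>2 - \<alpha>) * qnum b D + (b + 1) ^ 6 * b
          + ((real_of_int b + 1) ^ 3 * ((real_of_int b + 1)\<^sup>2 + 1) / 2 + 1) * \<alpha> - b)"
    proof (cases "\<alpha> \<le> b * (b + 1)")
      case False
      then show ?thesis using \<alpha> \<beta>_less by simp
    qed simp
  qed
qed

end
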